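(* Let $d\in\mathbb{N}_{\geq 2}$ and $\mathscr{C}\subset C([0,1]^{d-1},[0,1])$. Assume that there are $\alpha\geq\beta>0$ and $a,b\geq 0$ such that, for all $0<\varepsilon<1$, $$\varepsilon^{-1/\beta}\,\ln^b(2+\varepsilon^{-1})\;\gtrsim\; M_{\mathscr{C},L^1}(\varepsilon)\;\gtrsim\;\varepsilon^{-1/\alpha}\big/\ln^a(2+\varepsilon^{-1}),$$ with implied constants independent of $\varepsilon$. Then, for all $m\in\mathbb{N}$ and with implied constants independent of $m$, $$m^{-\alpha/(\beta+1)}\,[\ln(2m)]^{-\alpha(2+\beta b)/(\beta+1)-\alpha a}\;\lesssim\;\inf_{E:\Lambda^m\to\mathcal{D}\text{ measurable}}\;\sup_{p^*\in\mathcal{P}_{\mathscr{C}}}\;\mathbb{E}_{S=(S_1,\dots,S_m)\overset{iid}{\sim}p^*}\,d_H^2\bigl(E(S),p^*\bigr)\;\lesssim\; m^{-\beta/(\beta+1)}\,[\ln(2m)]^{(2+\beta b)/(\beta+1)} .$$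
   Context: $\Lambda:=[0,1]^d\times\{0,1\}$ is equipped with the measure $\lambda:=\boldsymbol{\lambda}\otimes\nu$, where $\boldsymbol{\lambda}$ is Lebesgue measure on $[0,1]^d$ and $\nu$ is the uniform probability measure on $\{0,1\}$. $\mathcal{D}$ is the set of all probability densities on $\Lambda$, i.e. measurable $p:\Lambda\to[0,\infty)$ with $\int_\Lambda p\,d\lambda=1$; it carries the Borel $\sigma$-algebra induced by $\|\cdot\|_{L^1(\lambda)}$. The notation $S_i\sim p^*$ means that $S_i$ has distribution $p^*\,d\lambda$. For $b:[0,1]^{d-1}\to[0,1]$, the horizon function $h_b:[0,1]^d\to\{0,1\}$ is $h_b(x)=1$ if $b(x_1,\dots,x_{d-1})\leq x_d$ and $h_b(x)=0$ otherwise. For measurable $b$, define $p_b:\Lambda\to[0,2]$ by $p_b(x,1)=2h_b(x)$ and $p_b(x,0)=2-2h_b(x)$; this is a probability density with respect to $\lambda$. Set $\mathcal{P}_{\mathscr{C}}:=\{p_b: b\in\mathscr{C}\}$. Hellinger distance: $d_H(p,q):=\bigl(\int_\Lambda(\sqrt p-\sqrt q)^2\,d\lambda\bigr)^{1/2}$. Packing entropy: for a nonempty subset $K$ of a set with distance function $\mathrm{dist}$ and $\varepsilon>0$, an $\varepsilon$-packing set in $K$ is a set $N\subset K$ with $\mathrm{dist}(x_1,x_2)>\varepsilon$ for all distinct $x_1,x_2\in N$. $M_{K,\mathrm{dist}}(\varepsilon)$ is the natural logarithm of the maximal cardinality of an $\varepsilon$-packing set in $K$. $M_{\mathscr{C},L^1}$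 denotes the packing entropy of $\mathscr{C}$ with respect to the $L^1$ distance (Lebesgue measure on $[0,1]^{d-1}$). *)

theory Defs
  imports "HOL-Analysis.Analysis"
begin

text \<open>
  Points of \<open>[0,1]\<^sup>n\<close> are extensional functions on \<open>{1..n}\<close>, so that \<open>x i\<close> is the \<open>i\<close>-th coordinate
  and \<open>n\<close> is an ordinary natural number. On \<open>unit_cube n\<close> the topology of the type \<^typ>\<open>nat \<Rightarrow> real\<close>
  (pointwise convergence) is the Euclidean one.
\<close>

definition unit_cube :: "nat \<Rightarrow> (nat \<Rightarrow> real) set" where
  "unit_cube n = {1..n} \<rightarrow>\<^sub>E {0..1}"

definition cube_measure :: "nat \<Rightarrow> (nat \<Rightarrow> real) measure" where
  "cube_measure n = (\<Pi>\<^sub>M i\<in>{1..n}. restrict_space lborel {0..1})"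

lemma space_cube_measure: "space (cube_measure n) = unit_cube n"
  by (simp add: cube_measure_def unit_cube_def space_PiM)

definition Lam :: "nat \<Rightarrow> ((nat \<Rightarrow> real) \<times> nat) set" where
  "Lam d = unit_cube d \<times> {0, 1}"

definition lam :: "nat \<Rightarrow> ((nat \<Rightarrow> real) \<times> nat) measure" where
  "lam d = cube_measure d \<Otimes>\<^sub>M uniform_count_measure {0, 1}"

lemma space_lam: "space (lam d) = Lam d"
  by (simp add: lam_def Lam_def space_pair_measure space_cube_measure space_uniform_count_measure)

text \<open>Functions on \<open>Lam d\<close> and on \<open>unit_cube n\<close> are extensional, so that they are determined by
  their values there.\<close>

definition densities :: "nat \<Rightarrow> ((nat \<Rightarrow> real) \<times> nat \<Rightarrow> real) set" where
  "densities d = {p \<in> Lam d \<rightarrow>\<^sub>E {0..}.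
     p \<in> borel_measurable (lam d) \<and> (\<integral>\<^sup>+z. ennreal (p z) \<partial>lam d) = 1}"

definition L1_dist :: "'a measure \<Rightarrow> ('a \<Rightarrow> real) \<Rightarrow> ('a \<Rightarrow> real) \<Rightarrow> real" where
  "L1_dist M f g = (\<integral>x. \<bar>f x - g x\<bar> \<partial>M)"

text \<open>Densities are functions, not classes modulo null sets: \<open>L1_dist\<close> is only a pseudometric on
  \<open>densities d\<close>, and \<open>density_space d\<close> carries the sigma-algebra generated by its open sets.\<close>

definition L1_open :: "nat \<Rightarrow> ((nat \<Rightarrow> real) \<times> nat \<Rightarrow> real) set \<Rightarrow> bool" where
  "L1_open d U \<longleftrightarrow> U \<subseteq> densities d \<and>
     (\<forall>p\<in>U. \<exists>r>0. \<forall>q\<in>densities d. L1_dist (lam d) p q < r \<longrightarrow> q \<in> U)"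

definition density_space :: "nat \<Rightarrow> ((nat \<Rightarrow> real) \<times> nat \<Rightarrow> real) measure" where
  "density_space d = sigma (densities d) {U. L1_open d U}"

definition iid_sample ::
  "nat \<Rightarrow> nat \<Rightarrow> ((nat \<Rightarrow> real) \<times> nat \<Rightarrow> real) \<Rightarrow> (nat \<Rightarrow> (nat \<Rightarrow> real) \<times> nat) measure" where
  "iid_sample d m p = (\<Pi>\<^sub>M i\<in>{1..m}. density (lam d) (\<lambda>z. ennreal (p z)))"

definition estimators ::
  "nat \<Rightarrow> nat \<Rightarrow> ((nat \<Rightarrow> (nat \<Rightarrow> real) \<times> nat) \<Rightarrow> ((nat \<Rightarrow> real) \<times> nat \<Rightarrow> real)) set" where
  "estimators d m = (\<Pi>\<^sub>M i\<in>{1..m}. lam d) \<rightarrow>\<^sub>M density_space d"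

definition hellinger ::
  "nat \<Rightarrow> ((nat \<Rightarrow> real) \<times> nat \<Rightarrow> real) \<Rightarrow> ((nat \<Rightarrow> real) \<times> nat \<Rightarrow> real) \<Rightarrow> real" where
  "hellinger d p q = sqrt (\<integral>z. (sqrt (p z) - sqrt (q z))\<^sup>2 \<partial>lam d)"

definition horizon :: "nat \<Rightarrow> ((nat \<Rightarrow> real) \<Rightarrow> real) \<Rightarrow> (nat \<Rightarrow> real) \<Rightarrow> real" where
  "horizon d b x = (if b (restrict x {1..d-1}) \<le> x d then 1 else 0)"

definition horizon_density ::
  "nat \<Rightarrow> ((nat \<Rightarrow> real) \<Rightarrow> real) \<Rightarrow> (nat \<Rightarrow> real) \<times> nat \<Rightarrow> real" where
  "horizon_density d b = (\<lambda>(x, y)\<in>Lam d. if y = 1 then 2 * horizon d b x else 2 - 2 * horizon d b x)"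

definition continuous_boundaries :: "nat \<Rightarrow> ((nat \<Rightarrow> real) \<Rightarrow> real) set" where
  "continuous_boundaries n = {b \<in> unit_cube n \<rightarrow>\<^sub>E {0..1}. continuous_on (unit_cube n) b}"

definition is_packing :: "'a set \<Rightarrow> ('a \<Rightarrow> 'a \<Rightarrow> real) \<Rightarrow> real \<Rightarrow> 'a set \<Rightarrow> bool" where
  "is_packing K dst \<epsilon> N \<longleftrightarrow> N \<subseteq> K \<and> (\<forall>x\<in>N. \<forall>y\<in>N. x \<noteq> y \<longrightarrow> dst x y > \<epsilon>)"

text \<open>Subsets of packing sets are packing sets, so the supremum over finite packing sets is the
  maximal cardinality, and it is infinite iff packing sets are arbitrarily large.\<close>

definition packing_number :: "'a set \<Rightarrow> ('a \<Rightarrow> 'a \<Rightarrow> real) \<Rightarrow> real \<Rightarrow> enat" where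
  "packing_number K dst \<epsilon> = (SUP N\<in>{N. is_packing K dst \<epsilon> N \<and> finite N}. enat (card N))"

definition packing_entropy :: "'a set \<Rightarrow> ('a \<Rightarrow> 'a \<Rightarrow> real) \<Rightarrow> real \<Rightarrow> ereal" where
  "packing_entropy K dst \<epsilon> =
     (case packing_number K dst \<epsilon> of enat n \<Rightarrow> ereal (ln (real n)) | \<infinity> \<Rightarrow> \<infinity>)"

end

theory Submission
  imports Defs "HOL-Probability.Probability" "HOL-Real_Asymp.Real_Asymp"
begin

text \<open>
  For horizon densities, the squared Hellinger distance and the probability of misclassification are
  both proportional to the \<open>L1\<close> distance of the boundaries. For the upper bound, minimize the
  number of misclassified sample points over a maximal \<open>\<epsilon>\<close>-packing, which is an \<open>\<epsilon>\<close>-cover; a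
  boundary at distance much larger than \<open>\<epsilon>\<close> wins against the one closest to the truth with
  probability at most \<open>exp (- K \<epsilon> m)\<close>, so a union bound needs \<open>\<epsilon> m\<close> to be of the order of the
  entropy at scale \<open>\<epsilon>\<close>.

  The Kullback--Leibler divergence of two different horizon densities is infinite, so Fano's
  inequality does not apply directly to the lower bound. Instead, the likelihood of each of \<open>M\<close>
  boundaries in a \<open>\<delta>\<close>-packing is dominated, off an event of probability \<open>1/2\<close>, by \<open>m powr (2 \<epsilon> m + 1)\<close> times the
  likelihood of one of \<open>N\<close> smoothed densities \<open>p + 2/m\<close> from an \<open>\<epsilon>\<close>-cover. The latter have total mass
  at most \<open>N e\<^sup>2\<close>, so that no test identifies the boundary once \<open>M\<close> is much larger than
  \<open>N * m powr (2 \<epsilon> m + 1)\<close>.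
\<close>

subsection \<open>Horizon densities\<close>

text \<open>Continuity refers to pointwise convergence of functions on all natural numbers, the
  measure to a finite product. The identity is measurable between the two because it is so in each
  coordinate.\<close>

lemma borel_measurable_cube:
  assumes "f \<in> continuous_boundaries n"
  shows "f \<in> borel_measurable (cube_measure n)"
proof -
  have cont: "continuous_on (unit_cube n) f"
    using assms by (simp add: continuous_boundaries_def)
  have "(\<lambda>x. x) \<in> cube_measure n \<rightarrow>\<^sub>M borel"
  proof (rule measurable_coordinatewise_then_product)
    fix i
    show "(\<lambda>x. x i) \<in> borel_measurable (cube_measure n)"
    proof (cases "i \<in> {1..n}")
      case True
      have "(\<lambda>x. x i) \<in> cube_measure n \<rightarrow>\<^sub>M restrict_space lborel {0..1::real}"
        unfolding cube_measure_def by (rule measurable_component_singleton[OF True])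
      from measurable_restrict_space2_iff[THEN iffD1, OF this] show ?thesis by simp
    next
      \<comment> \<open>Coordinates outside \<open>{1..n}\<close> are constantly
        \<open>undefined\<close> on extensional functions.\<close>
      case False
      then have "x i = undefined" if "x \<in> space (cube_measure n)" for x
        using that by (auto simp: cube_measure_def space_PiM PiE_def extensional_def)
      then show ?thesis
        by (subst measurable_cong[where g = "\<lambda>_. undefined"]) auto
    qed
  qed
  then have "(\<lambda>x. x) \<in> cube_measure n \<rightarrow>\<^sub>M restrict_space borel (unit_cube n)"
    by (intro measurable_restrict_space2) (auto simp: space_cube_measure)
  from measurable_compose[OF this borel_measurable_continuous_on_restrict[OF cont]]
  show ?thesis .
qed

lemma product_sigma_finite_unit_interval:
  "product_sigma_finite (\<lambda>_. restrict_space lborel {0..1::real})"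
  unfolding product_sigma_finite_def
  by (auto intro!: sigma_finite_measure_restrict_space lborel.sigma_finite_measure_axioms)

lemma prob_space_cube: "prob_space (cube_measure n)"
  unfolding cube_measure_def
  by (intro prob_space_PiM prob_space_restrict_space) auto

lemma prob_space_lam: "prob_space (lam d)"
proof -
  interpret A: prob_space "cube_measure d" by (rule prob_space_cube)
  interpret B: prob_space "uniform_count_measure {0, 1::nat}"
    by (rule prob_space_uniform_count_measure) auto
  interpret pair_prob_space "cube_measure d" "uniform_count_measure {0, 1::nat}" ..
  show ?thesis unfolding lam_def by (rule prob_space_axioms)
qed

lemma nn_integral_lam:
  assumes [measurable]: "f \<in> borel_measurable (lam d)"
  shows "(\<integral>\<^sup>+z. f z \<partial>lam d) = (\<integral>\<^sup>+x. (f (x, 0) + f (x, 1)) / 2 \<partial>cube_measure d)"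
proof -
  interpret B: prob_space "uniform_count_measure {0, 1::nat}"
    by (rule prob_space_uniform_count_measure) auto
  have [measurable]: "f \<in> borel_measurable (cube_measure d \<Otimes>\<^sub>M uniform_count_measure {0, 1})"
    using assms by (simp add: lam_def)
  have "(\<integral>\<^sup>+z. f z \<partial>lam d) = (\<integral>\<^sup>+x. \<integral>\<^sup>+y. f (x, y) \<partial>uniform_count_measure {0, 1} \<partial>cube_measure d)"
    unfolding lam_def by (rule B.nn_integral_fst[symmetric]) measurable
  also have "\<dots> = (\<integral>\<^sup>+x. (f (x, 0) + f (x, 1)) / 2 \<partial>cube_measure d)"
  proof (rule nn_integral_cong)
    fix x
    have half: "ennreal (1 / 2) = inverse 2"
      by (simp add: inverse_ennreal[symmetric] divide_ennreal_def flip: ennreal_numeral)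
    show "(\<integral>\<^sup>+y. f (x, y) \<partial>uniform_count_measure {0, 1}) = (f (x, 0) + f (x, 1)) / 2"
      unfolding uniform_count_measure_def
      by (subst nn_integral_point_measure_finite)
         (auto simp: half divide_ennreal_def distrib_left mult.commute)
  qed
  finally show ?thesis .
qed

section \<open>Disagreement of two horizon functions\<close>

lemma ennreal_abs_diff_indicator_integral:
  assumes "u \<in> {0..1::real}" "v \<in> {0..1}"
  shows "(\<integral>\<^sup>+t. indicator {t. (u \<le> t) \<noteq> (v \<le> t)} t \<partial>restrict_space lborel {0..1}) = ennreal \<bar>u - v\<bar>"
proof -
  \<comment> \<open>The two conditions differ exactly on the half-open interval from
    \<open>min u v\<close> to \<open>max u v\<close>, which lies in the unit interval.\<close>
  have "(\<integral>\<^sup>+t. indicator {t. (u \<le> t) \<noteq> (v \<le> t)} t \<partial>restrict_space lborel {0..1})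
      = (\<integral>\<^sup>+t. indicator {min u v..<max u v} t \<partial>lborel)"
    using assms by (subst nn_integral_restrict_space, simp, intro nn_integral_cong)
      (auto simp: indicator_def min_def max_def)
  also have "\<dots> = ennreal \<bar>u - v\<bar>"
    by (simp add: max_def min_def)
  finally show ?thesis .
qed

lemma horizon_measurable:
  assumes b: "b \<in> continuous_boundaries (d - 1)" and d: "d \<ge> 1"
  shows "horizon d b \<in> borel_measurable (cube_measure d)"
proof -
  have "(\<lambda>x. restrict x {1..d-1}) \<in> cube_measure d \<rightarrow>\<^sub>M cube_measure (d - 1)"
    unfolding cube_measure_def by (rule measurable_restrict_subset) auto
  from measurable_compose[OF this borel_measurable_cube[OF b]]
  have [measurable]: "(\<lambda>x. b (restrict x {1..d-1})) \<in> borel_measurable (cube_measure d)" .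
  have "(\<lambda>x. x d) \<in> cube_measure d \<rightarrow>\<^sub>M restrict_space lborel {0..1::real}"
    unfolding cube_measure_def by (rule measurable_component_singleton) (use d in auto)
  from measurable_restrict_space2_iff[THEN iffD1, OF this]
  have [measurable]: "(\<lambda>x. x d) \<in> borel_measurable (cube_measure d)" by simp
  show ?thesis unfolding horizon_def[abs_def] by measurable
qed

lemma horizon_disagreement_measurable:
  assumes b: "b \<in> continuous_boundaries (d - 1)" and b': "b' \<in> continuous_boundaries (d - 1)"
    and d: "d \<ge> 1"
  shows "(\<lambda>x. if horizon d b x \<noteq> horizon d b' x then 1 else 0 :: ennreal)
    \<in> borel_measurable (cube_measure d)"
proof -
  have "(\<lambda>x. ennreal \<bar>horizon d b x - horizon d b' x\<bar>) \<in> borel_measurable (cube_measure d)"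
    using horizon_measurable[OF b d] horizon_measurable[OF b' d] by simp
  also have "(\<lambda>x. ennreal \<bar>horizon d b x - horizon d b' x\<bar>)
      = (\<lambda>x. if horizon d b x \<noteq> horizon d b' x then 1 else 0)"
    by (auto simp: horizon_def)
  finally show ?thesis .
qed

text \<open>Fubini in the last coordinate: over a base point \<open>x\<close>, the two horizon
  functions disagree on an interval of length \<open>\<bar>b x - b' x\<bar>\<close>.\<close>

lemma horizon_disagreement:
  assumes b: "b \<in> continuous_boundaries (d - 1)" and b': "b' \<in> continuous_boundaries (d - 1)"
    and d: "d \<ge> 1"
  shows "(\<integral>\<^sup>+x. (if horizon d b x \<noteq> horizon d b' x then 1 else 0) \<partial>cube_measure d)
    = ennreal (L1_dist (cube_measure (d - 1)) b b')"
proof -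
  interpret product_sigma_finite "\<lambda>_::nat. restrict_space lborel {0..1::real}"
    by (rule product_sigma_finite_unit_interval)
  interpret C: prob_space "cube_measure (d - 1)" by (rule prob_space_cube)
  let ?f = "\<lambda>x. if horizon d b x \<noteq> horizon d b' x then 1 else 0 :: ennreal"
  note [measurable] = borel_measurable_cube[OF b] borel_measurable_cube[OF b']
  have f: "?f \<in> borel_measurable (cube_measure d)"
    by (rule horizon_disagreement_measurable[OF b b' d])
  have ins: "insert d {1..d-1} = {1..d}" using d by auto
  have eq: "cube_measure d = (\<Pi>\<^sub>M i\<in>insert d {1..d-1}. restrict_space lborel {0..1})"
    unfolding cube_measure_def ins ..
  have range: "b x \<in> {0..1} \<and> b' x \<in> {0..1}" if "x \<in> space (cube_measure (d - 1))" for x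
    using b b' that by (auto simp: continuous_boundaries_def space_cube_measure)
  have "(\<integral>\<^sup>+x. ?f x \<partial>cube_measure d)
      = (\<integral>\<^sup>+x. \<integral>\<^sup>+t. ?f (x(d := t)) \<partial>restrict_space lborel {0..1} \<partial>cube_measure (d - 1))"
    using f d unfolding eq by (subst product_nn_integral_insert) (auto simp: cube_measure_def)
  also have "\<dots> = (\<integral>\<^sup>+x. ennreal \<bar>b x - b' x\<bar> \<partial>cube_measure (d - 1))"
  proof (rule nn_integral_cong)
    fix x assume x: "x \<in> space (cube_measure (d - 1))"
    have "restrict (x(d := t)) {1..d-1} = x" for t
      using x d by (auto simp: space_cube_measure unit_cube_def fun_eq_iff PiE_def extensional_def restrict_def)
    then have "(\<integral>\<^sup>+t. ?f (x(d := t)) \<partial>restrict_space lborel {0..1})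
      = (\<integral>\<^sup>+t. indicator {t. (b x \<le> t) \<noteq> (b' x \<le> t)} t \<partial>restrict_space lborel {0..1})"
      by (intro nn_integral_cong) (auto simp: horizon_def)
    also have "\<dots> = ennreal \<bar>b x - b' x\<bar>"
      using range[OF x] by (intro ennreal_abs_diff_indicator_integral) auto
    finally show "(\<integral>\<^sup>+t. ?f (x(d := t)) \<partial>restrict_space lborel {0..1}) = ennreal \<bar>b x - b' x\<bar>" .
  qed
  also have "\<dots> = ennreal (L1_dist (cube_measure (d - 1)) b b')"
    unfolding L1_dist_def
  proof (rule nn_integral_eq_integral)
    show "integrable (cube_measure (d - 1)) (\<lambda>x. \<bar>b x - b' x\<bar>)"
    proof (rule C.integrable_const_bound[where B = 1])
      show "AE x in cube_measure (d - 1). norm \<bar>b x - b' x\<bar> \<le> 1"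
        using range by (intro AE_I2) (smt (verit) atLeastAtMost_iff real_norm_def)
    qed measurable
  qed auto
  finally show ?thesis .
qed

section \<open>Horizon densities: normalization, errors and Hellinger distance\<close>

lemma horizon_density_measurable [measurable]:
  assumes b: "b \<in> continuous_boundaries (d - 1)" and d: "d \<ge> 1"
  shows "horizon_density d b \<in> borel_measurable (lam d)"
proof -
  note [measurable] = horizon_measurable[OF b d]
  have "(\<lambda>z. if snd z = 1 then 2 * horizon d b (fst z) else 2 - 2 * horizon d b (fst z))
      \<in> borel_measurable (lam d)"
    unfolding lam_def by measurable
  then show ?thesis
    by (subst measurable_cong[where g = "\<lambda>z. if snd z = 1 then 2 * horizon d b (fst z)
       else 2 - 2 * horizon d b (fst z)"]) (auto simp: horizon_density_def space_lam)
qed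

lemma horizon_density_values: "z \<in> Lam d \<Longrightarrow> horizon_density d b z \<in> {0, 2}"
  by (cases z) (auto simp: horizon_density_def horizon_def)

text \<open>Over each point of the cube, the values at the two labels are 0 and 2 in some order,
  with average 1.\<close>

lemma horizon_density_in_densities:
  assumes b: "b \<in> continuous_boundaries (d - 1)" and d: "d \<ge> 1"
  shows "horizon_density d b \<in> densities d"
proof -
  interpret C: prob_space "cube_measure d" by (rule prob_space_cube)
  note [measurable] = horizon_density_measurable[OF b d]
  have "(\<integral>\<^sup>+z. ennreal (horizon_density d b z) \<partial>lam d) = (\<integral>\<^sup>+x. 1 \<partial>cube_measure d)"
    by (subst nn_integral_lam, measurable, intro nn_integral_cong)
       (simp add: horizon_density_def horizon_def Lam_def space_cube_measure)
  then show ?thesis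
    using horizon_density_measurable[OF b d] horizon_density_values[of _ d b]
    unfolding densities_def
    by (fastforce simp: C.emeasure_space_1 horizon_density_def PiE_def Pi_def)
qed

text \<open>Under \<open>horizon_density d b\<close> the label almost surely equals the horizon
  function of \<open>b\<close>, so the zero set of \<open>horizon_density d b'\<close> is the event
  that \<open>b'\<close> misclassifies the observation. The integral is the error probability of
  \<open>b'\<close>.\<close>

lemma nn_integral_horizon_density_null:
  assumes b: "b \<in> continuous_boundaries (d - 1)" and b': "b' \<in> continuous_boundaries (d - 1)"
    and d: "d \<ge> 1"
  shows "(\<integral>\<^sup>+z. ennreal (horizon_density d b z) * (if horizon_density d b' z = 0 then 1 else 0) \<partial>lam d)
    = ennreal (L1_dist (cube_measure (d - 1)) b b')"
proof -
  note [measurable] = horizon_density_measurable[OF b d] horizon_density_measurable[OF b' d]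
  show ?thesis
    by (subst nn_integral_lam, measurable, subst horizon_disagreement[OF assms, symmetric])
       (auto intro!: nn_integral_cong simp: horizon_density_def horizon_def Lam_def space_cube_measure)
qed

lemma hellinger_sq:
  "(hellinger d p q)\<^sup>2 = (\<integral>z. (sqrt (p z) - sqrt (q z))\<^sup>2 \<partial>lam d)"
  unfolding hellinger_def by (intro real_sqrt_pow2 integral_nonneg) auto

text \<open>Where the horizon functions disagree, one density is 0 and the other 2 at either label,
  so the integrand is 2 at both labels; elsewhere it is 0.\<close>

lemma hellinger_horizon_density:
  assumes b: "b \<in> continuous_boundaries (d - 1)" and b': "b' \<in> continuous_boundaries (d - 1)"
    and d: "d \<ge> 1"
  shows "(hellinger d (horizon_density d b) (horizon_density d b'))\<^sup>2
    = 2 * L1_dist (cube_measure (d - 1)) b b'"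
proof -
  note [measurable] = horizon_density_measurable[OF b d] horizon_density_measurable[OF b' d]
    horizon_measurable[OF b d] horizon_measurable[OF b' d]
  let ?p = "horizon_density d b" and ?q = "horizon_density d b'"
  have four: "(4::ennreal) / 2 = 2" using divide_ennreal[of 4 2] by simp
  have "(\<integral>\<^sup>+z. ennreal ((sqrt (?p z) - sqrt (?q z))\<^sup>2) \<partial>lam d)
      = (\<integral>\<^sup>+x. 2 * (if horizon d b x \<noteq> horizon d b' x then 1 else 0) \<partial>cube_measure d)"
    by (subst nn_integral_lam, measurable, intro nn_integral_cong)
       (auto simp: horizon_density_def horizon_def Lam_def space_cube_measure four)
  also have "\<dots> = ennreal (2 * L1_dist (cube_measure (d - 1)) b b')"
    using horizon_disagreement_measurable[OF assms]
    by (subst nn_integral_cmult) (auto simp: horizon_disagreement[OF assms] ennreal_mult' L1_dist_def)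
  finally show ?thesis
    unfolding hellinger_sq by (subst integral_eq_nn_integral) (auto simp: L1_dist_def)
qed

subsection \<open>Empirical risk minimization\<close>

lemma L1_dist_commute: "L1_dist M f g = L1_dist M g f"
  by (simp add: L1_dist_def abs_minus_commute)

lemma L1_dist_nonneg: "0 \<le> L1_dist M f g"
  by (simp add: L1_dist_def)

lemma L1_dist_boundaries_le_1:
  assumes b: "b \<in> continuous_boundaries n" and b': "b' \<in> continuous_boundaries n"
  shows "L1_dist (cube_measure n) b b' \<le> 1"
proof -
  interpret C: prob_space "cube_measure n" by (rule prob_space_cube)
  have "\<bar>b x - b' x\<bar> \<le> 1" if "x \<in> space (cube_measure n)" for x
  proof -
    have "b x \<in> {0..1}" "b' x \<in> {0..1}"
      using b b' that by (auto simp: continuous_boundaries_def space_cube_measure)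
    then show ?thesis by auto
  qed
  then have "L1_dist (cube_measure n) b b' \<le> (\<integral>x. 1 \<partial>cube_measure n)"
    unfolding L1_dist_def by (intro integral_mono') auto
  then show ?thesis by (simp add: C.prob_space)
qed

section \<open>Independent samples and their likelihoods\<close>

lemma densities_measurable: "p \<in> densities d \<Longrightarrow> p \<in> borel_measurable (lam d)"
  by (simp add: densities_def)

lemma prob_space_density_lam:
  assumes "p \<in> densities d"
  shows "prob_space (density (lam d) (\<lambda>z. ennreal (p z)))"
proof (rule prob_spaceI)
  let ?p = "\<lambda>z. ennreal (p z)"
  have "emeasure (density (lam d) ?p) (space (lam d))
      = (\<integral>\<^sup>+z. ?p z * indicator (space (lam d)) z \<partial>lam d)"
    using assms by (intro emeasure_density) (auto simp: densities_def)
  also have "\<dots> = (\<integral>\<^sup>+z. ?p z \<partial>lam d)"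
    by (intro nn_integral_cong) auto
  finally show "emeasure (density (lam d) ?p) (space (density (lam d) ?p)) = 1"
    using assms by (simp add: densities_def)
qed

lemma prob_space_iid_sample: "p \<in> densities d \<Longrightarrow> prob_space (iid_sample d m p)"
  unfolding iid_sample_def by (intro prob_space_PiM prob_space_density_lam)

lemma product_sigma_finite_density_lam:
  "p \<in> densities d \<Longrightarrow> product_sigma_finite (\<lambda>_::nat. density (lam d) (\<lambda>z. ennreal (p z)))"
  unfolding product_sigma_finite_def
  by (intro allI prob_space_imp_sigma_finite prob_space_density_lam)

lemma product_sigma_finite_lam: "product_sigma_finite (\<lambda>_::nat. lam d)"
  unfolding product_sigma_finite_def
  by (intro allI prob_space_imp_sigma_finite prob_space_lam)

lemma sets_iid_sample [measurable_cong]: "sets (iid_sample d m p) = sets (\<Pi>\<^sub>M i\<in>{1..m}. lam d)"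
  unfolding iid_sample_def by (intro sets_PiM_cong) auto

lemma nn_integral_iid_sample_prod:
  assumes p: "p \<in> densities d" and [measurable]: "f \<in> borel_measurable (lam d)"
  shows "(\<integral>\<^sup>+S. (\<Prod>i\<in>{1..m}. f (S i)) \<partial>iid_sample d m p) = (\<integral>\<^sup>+z. ennreal (p z) * f z \<partial>lam d) ^ m"
proof -
  interpret product_sigma_finite "\<lambda>_::nat. density (lam d) (\<lambda>z. ennreal (p z))"
    by (rule product_sigma_finite_density_lam[OF p])
  note [measurable] = densities_measurable[OF p]
  show ?thesis
    unfolding iid_sample_def
    by (subst product_nn_integral_prod) (auto simp: nn_integral_density)
qed

text \<open>With all sample laws written as densities with respect to one product measure, the
  likelihoods of different boundaries can be compared pointwise.\<close>

lemma iid_sample_density: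
  assumes p: "p \<in> densities d"
  shows "iid_sample d m p =
    density (\<Pi>\<^sub>M i\<in>{1..m}. lam d) (\<lambda>S. \<Prod>i\<in>{1..m}. ennreal (p (S i)))" (is "_ = density ?M ?w")
proof -
  interpret P: product_sigma_finite "\<lambda>_::nat. density (lam d) (\<lambda>z. ennreal (p z))"
    by (rule product_sigma_finite_density_lam[OF p])
  interpret L: product_sigma_finite "\<lambda>_::nat. lam d" by (rule product_sigma_finite_lam)
  note [measurable] = densities_measurable[OF p]
  have [measurable]: "?w \<in> borel_measurable ?M" by measurable
  show ?thesis
    unfolding iid_sample_def
  proof (rule P.PiM_eqI[symmetric])
    show "sets (density ?M ?w) = sets (\<Pi>\<^sub>M i\<in>{1..m}. density (lam d) (\<lambda>z. ennreal (p z)))"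
      using sets_iid_sample[of d m p] by (simp add: iid_sample_def)
    fix A assume A: "A i \<in> sets (density (lam d) (\<lambda>z. ennreal (p z)))" if "i \<in> {1..m}" for i
    then have [measurable]: "A i \<in> sets (lam d)" if "i \<in> {1..m}" for i
      using that by simp
    have "emeasure (density ?M ?w) (Pi\<^sub>E {1..m} A) = (\<integral>\<^sup>+S. ?w S * indicator (Pi\<^sub>E {1..m} A) S \<partial>?M)"
      by (rule emeasure_density) (auto intro!: sets_PiM_I_finite)
    also have "\<dots> = (\<integral>\<^sup>+S. (\<Prod>i\<in>{1..m}. ennreal (p (S i)) * indicator (A i) (S i)) \<partial>?M)"
    proof (rule nn_integral_cong)
      fix S assume "S \<in> space ?M"
      then have "indicator (Pi\<^sub>E {1..m} A) S = (\<Prod>i\<in>{1..m}. indicator (A i) (S i) :: ennreal)"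
        by (auto simp: space_PiM PiE_iff indicator_def prod_zero_iff)
      then show "?w S * indicator (Pi\<^sub>E {1..m} A) S
          = (\<Prod>i\<in>{1..m}. ennreal (p (S i)) * indicator (A i) (S i))"
        by (simp add: prod.distrib)
    qed
    also have "\<dots> = (\<Prod>i\<in>{1..m}. \<integral>\<^sup>+z. ennreal (p z) * indicator (A i) z \<partial>lam d)"
      by (rule L.product_nn_integral_prod) auto
    also have "\<dots> = (\<Prod>i\<in>{1..m}. emeasure (density (lam d) (\<lambda>z. ennreal (p z))) (A i))"
      by (intro prod.cong) (auto simp: emeasure_density)
    finally show "emeasure (density ?M ?w) (Pi\<^sub>E {1..m} A)
      = (\<Prod>i\<in>{1..m}. emeasure (density (lam d) (\<lambda>z. ennreal (p z))) (A i))" .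
  qed auto
qed

section \<open>Exponential bounds and the minimizer of the empirical error\<close>

lemma space_density_space: "space (density_space d) = densities d"
  unfolding density_space_def by (rule space_measure_of) (auto simp: L1_open_def)

text \<open>A Chernoff estimate for one observation: \<open>c\<close> is a candidate near the truth
  \<open>b\<close>, \<open>c'\<close> a distant one, and the exponent is the excess of the error of
  \<open>c\<close> over that of \<open>c'\<close>. The integral is at most 1 plus 3/2 of the
  distance of \<open>c\<close> minus 1/2 of the distance of \<open>c'\<close>; the factor
  \<open>3 + 2 * K\<close> makes this at most \<open>1 - K * \<epsilon>\<close>.\<close>

lemma nn_integral_exponential_loss:
  assumes b: "b \<in> continuous_boundaries (d - 1)" and c: "c \<in> continuous_boundaries (d - 1)"
    and c': "c' \<in> continuous_boundaries (d - 1)" and d: "d \<ge> 1"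
    and close: "L1_dist (cube_measure (d - 1)) b c \<le> \<epsilon>"
    and far: "(3 + 2 * K) * \<epsilon> \<le> L1_dist (cube_measure (d - 1)) b c'"
  shows "(\<integral>\<^sup>+z. ennreal (horizon_density d b z) * ennreal (2 powr
      ((if horizon_density d c z = 0 then 1 else 0) - (if horizon_density d c' z = 0 then 1 else 0))) \<partial>lam d)
    \<le> ennreal (exp (- K * \<epsilon>))" (is "?I \<le> _")
proof -
  let ?p = "horizon_density d b"
  let ?X = "\<lambda>z. if horizon_density d c z = 0 then 1 else 0 :: real"
  let ?X' = "\<lambda>z. if horizon_density d c' z = 0 then 1 else 0 :: real"
  let ?d = "L1_dist (cube_measure (d - 1)) b"
  note [measurable] = horizon_density_measurable[OF b d] horizon_density_measurable[OF c d]
    horizon_density_measurable[OF c' d]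
  have null: "(\<integral>\<^sup>+z. ennreal (?p z) * ennreal (s * (if horizon_density d e z = 0 then 1 else 0)) \<partial>lam d) = ennreal (s * ?d e)"
    if e: "e \<in> continuous_boundaries (d - 1)" and s: "s \<ge> 0" for e s
  proof -
    note [measurable] = horizon_density_measurable[OF e d]
    have "(\<integral>\<^sup>+z. ennreal (?p z) * ennreal (s * (if horizon_density d e z = 0 then 1 else 0)) \<partial>lam d)
      = (\<integral>\<^sup>+z. ennreal s * (ennreal (?p z) * (if horizon_density d e z = 0 then 1 else 0)) \<partial>lam d)"
      using s by (intro nn_integral_cong) (auto simp: ennreal_mult mult.commute)
    also have "\<dots> = ennreal s * ennreal (?d e)"
      by (subst nn_integral_cmult, measurable) (simp add: nn_integral_horizon_density_null[OF b e d])
    finally show ?thesis using s by (simp add: ennreal_mult L1_dist_nonneg)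
  qed
  have total: "(\<integral>\<^sup>+z. ennreal (?p z) \<partial>lam d) = 1"
    using horizon_density_in_densities[OF b d] by (simp add: densities_def)
  \<comment> \<open>The distance of \<open>c'\<close> is added on the left because subtraction
    truncates in \<open>ennreal\<close>; it changes sides once \<open>?I\<close> is known to be
    finite.\<close>
  have "?I + ennreal (1 / 2 * ?d c')
      = (\<integral>\<^sup>+z. ennreal (?p z) * (ennreal (2 powr (?X z - ?X' z)) + ennreal (1 / 2 * ?X' z)) \<partial>lam d)"
    by (subst null[OF c', symmetric]) (simp_all add: nn_integral_add[symmetric] distrib_left)
  also have "\<dots> \<le> (\<integral>\<^sup>+z. ennreal (?p z) * (1 + ennreal (3 / 2 * ?X z)) \<partial>lam d)"
  proof (intro nn_integral_mono mult_left_mono)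
    fix z
    \<comment> \<open>A check of the four pairs of error indicators, with equality whenever
      \<open>c\<close> makes no error at \<open>z\<close>.\<close>
    have "2 powr (?X z - ?X' z) + 1 / 2 * ?X' z \<le> 1 + 3 / 2 * ?X z"
      by (simp add: powr_minus)
    then have "ennreal (2 powr (?X z - ?X' z) + 1 / 2 * ?X' z) \<le> ennreal (1 + 3 / 2 * ?X z)"
      by (rule ennreal_leI)
    then show "ennreal (2 powr (?X z - ?X' z)) + ennreal (1 / 2 * ?X' z) \<le> 1 + ennreal (3 / 2 * ?X z)"
      by (subst (asm) (1 2) ennreal_plus) simp_all
  qed simp
  also have "\<dots> = 1 + ennreal (3 / 2 * ?d c)"
    by (subst null[OF c, symmetric]) (simp_all add: distrib_left nn_integral_add total)
  also have "\<dots> = ennreal (1 + 3 / 2 * ?d c)"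
    by (subst ennreal_plus) (auto simp: L1_dist_nonneg)
  finally have *: "?I + ennreal (1 / 2 * ?d c') \<le> ennreal (1 + 3 / 2 * ?d c)" .
  then have "?I \<noteq> \<top>" by (auto simp: top_unique)
  then obtain r where r: "?I = ennreal r" "r \<ge> 0" by (cases ?I) auto
  have "ennreal (r + 1 / 2 * ?d c') \<le> ennreal (1 + 3 / 2 * ?d c)"
    using * r by (subst ennreal_plus) (auto simp: L1_dist_nonneg)
  then have "r + 1 / 2 * ?d c' \<le> 1 + 3 / 2 * ?d c"
    by (subst (asm) ennreal_le_iff) (auto simp: L1_dist_nonneg)
  then have "r \<le> 1 + (- K * \<epsilon>)" using close far by (simp add: algebra_simps)
  also have "\<dots> \<le> exp (- K * \<epsilon>)" by (rule exp_ge_add_one_self)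
  finally show ?thesis using r by (simp add: ennreal_leI)
qed

theorem empirical_risk_minimizer:
  fixes f :: "nat \<Rightarrow> (nat \<Rightarrow> real) \<Rightarrow> real"
  assumes f: "\<And>j. j < k \<Longrightarrow> f j \<in> continuous_boundaries (d - 1)"
    and k: "k > 0" and d: "d \<ge> 1" and K: "K \<ge> 0" and \<epsilon>: "\<epsilon> \<ge> 0"
  obtains E where "E \<in> estimators d m"
    "\<And>b l. b \<in> continuous_boundaries (d - 1) \<Longrightarrow> l < k \<Longrightarrow> L1_dist (cube_measure (d - 1)) b (f l) \<le> \<epsilon> \<Longrightarrow>
      (\<integral>\<^sup>+S. ennreal ((hellinger d (E S) (horizon_density d b))\<^sup>2) \<partial>iid_sample d m (horizon_density d b))
        \<le> ennreal (2 * (3 + 2 * K) * \<epsilon> + 2 * real k * exp (- K * \<epsilon> * real m))"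
proof -
  let ?M = "\<Pi>\<^sub>M i\<in>{1..m}. lam d"
  \<comment> \<open>Indices from \<open>k\<close> on are redirected to 0, so that measurability and
    membership in \<open>densities d\<close> hold for every natural number.\<close>
  define X :: "nat \<Rightarrow> (nat \<Rightarrow> real) \<times> nat \<Rightarrow> real"
    where "X j z = (if horizon_density d (f (if j < k then j else 0)) z = 0 then 1 else 0)" for j z
  define cnt where "cnt j S = (\<Sum>i\<in>{1..m}. X j (S i))" for j and S :: "nat \<Rightarrow> (nat \<Rightarrow> real) \<times> nat"
  \<comment> \<open>Ties are broken by the least index, which keeps the selection
    measurable.\<close>
  define sel where "sel S = (LEAST j. j < k \<and> (\<forall>l. l < k \<longrightarrow> cnt j S \<le> cnt l S))" for S
  define g where "g j = horizon_density d (f (if j < k then j else 0))" for j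
  have f': "f (if j < k then j else 0) \<in> continuous_boundaries (d - 1)" for j
    using f k by auto
  have X[measurable]: "X j \<in> borel_measurable (lam d)" for j
    unfolding X_def[abs_def] using horizon_density_measurable[OF f' d, of j] by measurable
  have cnt: "cnt j \<in> borel_measurable ?M" for j
    unfolding cnt_def[abs_def] by measurable
  have le: "Measurable.pred ?M (\<lambda>S. cnt j S \<le> cnt l S)" for j l
    unfolding pred_def by (rule borel_measurable_le; rule cnt)
  have "sel \<in> ?M \<rightarrow>\<^sub>M count_space UNIV"
    unfolding sel_def[abs_def]
    by (rule measurable_Least) (intro pred_intros_logic pred_intros_countable le measurable_const; simp)
  moreover have "g \<in> count_space UNIV \<rightarrow>\<^sub>M density_space d"
    using horizon_density_in_densities[OF f' d] by (simp add: space_density_space g_def Pi_def)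
  ultimately have "(\<lambda>S. g (sel S)) \<in> estimators d m"
    unfolding estimators_def by (rule measurable_compose)
  moreover have "(\<integral>\<^sup>+S. ennreal ((hellinger d (g (sel S)) (horizon_density d b))\<^sup>2) \<partial>iid_sample d m (horizon_density d b))
        \<le> ennreal (2 * (3 + 2 * K) * \<epsilon> + 2 * real k * exp (- K * \<epsilon> * real m))"
    if b: "b \<in> continuous_boundaries (d - 1)" and l: "l < k"
      and close: "L1_dist (cube_measure (d - 1)) b (f l) \<le> \<epsilon>" for b l
  proof -
    let ?p = "horizon_density d b" and ?d = "L1_dist (cube_measure (d - 1)) b"
    define w where "w j z = ennreal (2 powr (X l z - X j z))" for j z
    define J where "J = {j. j < k \<and> (3 + 2 * K) * \<epsilon> \<le> ?d (f j)}"
    have p: "?p \<in> densities d" by (rule horizon_density_in_densities[OF b d])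
    interpret P: prob_space "iid_sample d m ?p" by (rule prob_space_iid_sample[OF p])
    have [measurable]: "w j \<in> borel_measurable (lam d)" for j
      unfolding w_def[abs_def] by measurable
    have J: "finite J" "card J \<le> k"
      using card_mono[of "{..<k}" J] by (auto simp: J_def)
    \<comment> \<open>A near selection costs at most the first summand. A far one costs at most 2,
      and its term in the sum is at least 2 because the selected candidate makes no more errors than
      candidate \<open>l\<close>.\<close>
    have pw: "ennreal ((hellinger d (g (sel S)) ?p)\<^sup>2)
        \<le> ennreal (2 * (3 + 2 * K) * \<epsilon>) + (\<Sum>j\<in>J. 2 * (\<Prod>i\<in>{1..m}. w j (S i)))" for S
    proof -
      have "\<exists>j. is_arg_min (\<lambda>j. cnt j S) (\<lambda>j. j \<in> {..<k}) j"
        using k by (intro ex_is_arg_min_if_finite) auto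
      then have "\<exists>j. j < k \<and> (\<forall>l. l < k \<longrightarrow> cnt j S \<le> cnt l S)"
        by (auto simp: is_arg_min_linorder)
      from LeastI_ex[OF this, folded sel_def]
      have sel: "sel S < k" "cnt (sel S) S \<le> cnt l S" using l by auto
      have h: "(hellinger d (g (sel S)) ?p)\<^sup>2 = 2 * ?d (f (sel S))"
        using sel hellinger_horizon_density[OF f[OF sel(1)] b d] by (simp add: g_def L1_dist_commute)
      show ?thesis
      proof (cases "sel S \<in> J")
        case True
        have "2 powr (\<Sum>i\<in>{1..m}. X l (S i) - X (sel S) (S i)) \<ge> 2 powr 0"
          using sel(2) by (intro powr_mono) (auto simp: cnt_def sum_subtractf)
        then have "1 \<le> (\<Prod>i\<in>{1..m}. 2 powr (X l (S i) - X (sel S) (S i)))"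
          by (subst (asm) powr_sum) auto
        then have 1: "1 \<le> (\<Prod>i\<in>{1..m}. w (sel S) (S i))"
          unfolding w_def by (subst prod_ennreal) auto
        have "ennreal ((hellinger d (g (sel S)) ?p)\<^sup>2) \<le> ennreal (2 * 1)"
          unfolding h using L1_dist_boundaries_le_1[OF b f[OF sel(1)]] by (intro ennreal_leI) auto
        also have "\<dots> \<le> 2 * (\<Prod>i\<in>{1..m}. w (sel S) (S i))"
          using mult_left_mono[OF 1, of 2] by simp
        also have "\<dots> \<le> (\<Sum>j\<in>J. 2 * (\<Prod>i\<in>{1..m}. w j (S i)))"
          using True J by (intro member_le_sum) auto
        finally show ?thesis by (simp add: add_increasing)
      next
        case False
        then have "?d (f (sel S)) \<le> (3 + 2 * K) * \<epsilon>" using sel by (auto simp: J_def)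
        then have "ennreal ((hellinger d (g (sel S)) ?p)\<^sup>2) \<le> ennreal (2 * (3 + 2 * K) * \<epsilon>)"
          unfolding h by (intro ennreal_leI) (simp add: algebra_simps)
        then show ?thesis by (simp add: add_increasing2)
      qed
    qed
    have w: "(\<integral>\<^sup>+z. ennreal (?p z) * w j z \<partial>lam d) \<le> ennreal (exp (- K * \<epsilon>))" if "j \<in> J" for j
    proof -
      have j: "j < k" "(3 + 2 * K) * \<epsilon> \<le> ?d (f j)" using that by (auto simp: J_def)
      show ?thesis
        using nn_integral_exponential_loss[OF b f[OF l] f[OF j(1)] d close j(2)]
        by (simp only: w_def X_def l j(1) if_True)
    qed
    have "(\<integral>\<^sup>+S. ennreal ((hellinger d (g (sel S)) ?p)\<^sup>2) \<partial>iid_sample d m ?p)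
      \<le> (\<integral>\<^sup>+S. ennreal (2 * (3 + 2 * K) * \<epsilon>) + (\<Sum>j\<in>J. 2 * (\<Prod>i\<in>{1..m}. w j (S i))) \<partial>iid_sample d m ?p)"
      by (intro nn_integral_mono pw)
    also have "\<dots> = ennreal (2 * (3 + 2 * K) * \<epsilon>)
        + (\<Sum>j\<in>J. 2 * (\<integral>\<^sup>+S. (\<Prod>i\<in>{1..m}. w j (S i)) \<partial>iid_sample d m ?p))"
      by (simp add: nn_integral_add nn_integral_sum nn_integral_cmult P.emeasure_space_1)
    also have "\<dots> = ennreal (2 * (3 + 2 * K) * \<epsilon>) + (\<Sum>j\<in>J. 2 * (\<integral>\<^sup>+z. ennreal (?p z) * w j z \<partial>lam d) ^ m)"
      by (subst nn_integral_iid_sample_prod[OF p]) auto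
    also have "\<dots> \<le> ennreal (2 * (3 + 2 * K) * \<epsilon>) + (\<Sum>j\<in>J. 2 * ennreal (exp (- K * \<epsilon>)) ^ m)"
      by (intro add_left_mono sum_mono mult_left_mono power_mono w) auto
    also have "(\<Sum>j\<in>J. 2 * ennreal (exp (- K * \<epsilon>)) ^ m) = ennreal (real (card J) * (2 * exp (- K * \<epsilon> * real m)))"
      by (simp add: ennreal_power exp_of_nat_mult[symmetric] ennreal_mult ennreal_of_nat_eq_real_of_nat mult.commute mult.left_commute)
    also have "ennreal (2 * (3 + 2 * K) * \<epsilon>) + \<dots> = ennreal (2 * (3 + 2 * K) * \<epsilon> + real (card J) * (2 * exp (- K * \<epsilon> * real m)))"
      using K \<epsilon> by (subst ennreal_plus) auto
    also have "\<dots> \<le> ennreal (2 * (3 + 2 * K) * \<epsilon> + 2 * real k * exp (- K * \<epsilon> * real m))"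
      using J by (intro ennreal_leI add_left_mono) (auto intro!: mult_right_mono)
    finally show ?thesis .
  qed
  ultimately show thesis by (rule that)
qed

subsection \<open>Lower bound from packings\<close>

lemma density_integrable: "p \<in> densities d \<Longrightarrow> integrable (lam d) p"
  by (rule integrableI_nonneg) (auto simp: densities_def space_lam PiE_iff intro!: AE_I2)

lemma density_nonneg: "p \<in> densities d \<Longrightarrow> z \<in> space (lam d) \<Longrightarrow> 0 \<le> p z"
  by (auto simp: densities_def space_lam PiE_iff)

lemma sqrt_diff_sq_le_abs:
  assumes "u \<ge> 0" "v \<ge> 0"
  shows "(sqrt u - sqrt v)\<^sup>2 \<le> \<bar>u - v\<bar>"
proof -
  have "\<bar>sqrt u - sqrt v\<bar> \<le> sqrt u + sqrt v"
    using assms by (simp add: abs_le_iff)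
  then have "\<bar>sqrt u - sqrt v\<bar> * \<bar>sqrt u - sqrt v\<bar> \<le> \<bar>sqrt u - sqrt v\<bar> * (sqrt u + sqrt v)"
    by (rule mult_left_mono) simp
  also have "\<dots> = \<bar>(sqrt u - sqrt v) * (sqrt u + sqrt v)\<bar>"
    using assms by (simp add: abs_mult)
  also have "(sqrt u - sqrt v) * (sqrt u + sqrt v) = u - v"
    using assms by (simp add: algebra_simps)
  finally show ?thesis by (simp add: power2_eq_square)
qed

lemma hellinger_integrable:
  assumes p: "p \<in> densities d" and q: "q \<in> densities d"
  shows "integrable (lam d) (\<lambda>z. (sqrt (p z) - sqrt (q z))\<^sup>2)"
proof (rule Bochner_Integration.integrable_bound)
  show "integrable (lam d) (\<lambda>z. \<bar>p z - q z\<bar>)"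
    using assms[THEN density_integrable] by simp
  show "(\<lambda>z. (sqrt (p z) - sqrt (q z))\<^sup>2) \<in> borel_measurable (lam d)"
    using assms[THEN densities_measurable] by simp
  show "AE z in lam d. norm ((sqrt (p z) - sqrt (q z))\<^sup>2) \<le> norm \<bar>p z - q z\<bar>"
    using assms[THEN density_nonneg] by (intro AE_I2) (simp add: sqrt_diff_sq_le_abs)
qed

text \<open>This comparison makes Hellinger balls open for \<open>L1_dist\<close>, hence measurable
  in \<open>density_space d\<close>.\<close>

lemma hellinger_sq_le_L1_dist:
  assumes p: "p \<in> densities d" and q: "q \<in> densities d"
  shows "(hellinger d p q)\<^sup>2 \<le> L1_dist (lam d) p q"
  unfolding hellinger_sq L1_dist_def
  using hellinger_integrable[OF assms] assms[THEN density_integrable] assms[THEN density_nonneg]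
  by (intro integral_mono) (simp_all add: sqrt_diff_sq_le_abs)

lemma hellinger_commute: "hellinger d p q = hellinger d q p"
  by (simp add: hellinger_def power2_commute)

text \<open>Young's inequality under the integral, in place of the triangle inequality. The weight
  \<open>s\<close> is adapted to the available gap when a ball is shown to be open, and is 1 when
  balls are shown to be disjoint.\<close>

lemma hellinger_quasi_triangle:
  assumes p: "p \<in> densities d" and q: "q \<in> densities d" and r: "r \<in> densities d" and s: "s > 0"
  shows "(hellinger d p r)\<^sup>2 \<le> (1 + s) * (hellinger d p q)\<^sup>2 + (1 + 1 / s) * (hellinger d q r)\<^sup>2"
proof -
  have young: "(u + v)\<^sup>2 \<le> (1 + s) * u\<^sup>2 + (1 + 1 / s) * v\<^sup>2" for u v :: real
  proof -
    have "(1 + s) * u\<^sup>2 + (1 + 1 / s) * v\<^sup>2 - (u + v)\<^sup>2 = (s * u - v)\<^sup>2 / s"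
      using s by (simp add: field_simps power2_eq_square)
    then show ?thesis using s by (smt (verit) divide_nonneg_pos zero_le_power2)
  qed
  note i = hellinger_integrable[OF p q] hellinger_integrable[OF q r] hellinger_integrable[OF p r]
  have "(hellinger d p r)\<^sup>2 \<le> (\<integral>z. (1 + s) * (sqrt (p z) - sqrt (q z))\<^sup>2
      + (1 + 1 / s) * (sqrt (q z) - sqrt (r z))\<^sup>2 \<partial>lam d)"
    unfolding hellinger_sq
  proof (rule integral_mono)
    show "(sqrt (p z) - sqrt (r z))\<^sup>2 \<le> (1 + s) * (sqrt (p z) - sqrt (q z))\<^sup>2
      + (1 + 1 / s) * (sqrt (q z) - sqrt (r z))\<^sup>2" for z
      using young[of "sqrt (p z) - sqrt (q z)" "sqrt (q z) - sqrt (r z)"] by simp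
  qed (use i in auto)
  also have "\<dots> = (1 + s) * (hellinger d p q)\<^sup>2 + (1 + 1 / s) * (hellinger d q r)\<^sup>2"
    unfolding hellinger_sq using i by (subst Bochner_Integration.integral_add) auto
  finally show ?thesis .
qed

lemma hellinger_ball_measurable:
  assumes p: "p \<in> densities d"
  shows "{q \<in> densities d. (hellinger d q p)\<^sup>2 < t} \<in> sets (density_space d)" (is "?B \<in> _")
proof -
  have "L1_open d ?B"
    unfolding L1_open_def
  proof (intro conjI ballI)
    fix q assume "q \<in> ?B"
    then have q: "q \<in> densities d" and lt: "(hellinger d q p)\<^sup>2 < t" by auto
    define A where "A = (hellinger d q p)\<^sup>2"
    have A: "A \<ge> 0" "A < t" using lt by (auto simp: A_def)
    \<comment> \<open>The gap \<open>t - A\<close> is split into halves. Since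
      \<open>s * (A + 1)\<close> equals one half, the factor \<open>1 + s\<close> enlarges
      \<open>A\<close> by less than that; the summand 1 also keeps the denominator positive.\<close>
    define s where "s = (t - A) / (2 * (A + 1))"
    have s: "s > 0" using A by (simp add: s_def)
    have "s * (A + 1) = (t - A) / 2" using A by (simp add: s_def field_simps)
    then have sA: "(1 + s) * A < (t + A) / 2" using s by (simp add: algebra_simps)
    \<comment> \<open>The radius uses up the second half of the gap after multiplication by
      \<open>1 + 1 / s\<close>.\<close>
    define r where "r = (t - A) / 2 / (1 + 1 / s)"
    have r: "r > 0" using A s by (auto simp: r_def intro!: divide_pos_pos add_pos_pos)
    have r2: "(1 + 1 / s) * r = (t - A) / 2"
      unfolding r_def using s by (subst times_divide_eq_right, subst nonzero_mult_div_cancel_left) (auto simp: add_pos_pos less_imp_neq[symmetric])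
    have "q' \<in> ?B" if q': "q' \<in> densities d" and L: "L1_dist (lam d) q q' < r" for q'
    proof -
      have "(hellinger d q q')\<^sup>2 \<le> r" using hellinger_sq_le_L1_dist[OF q q'] L by simp
      then have "(1 + 1 / s) * (hellinger d q q')\<^sup>2 \<le> (1 + 1 / s) * r"
        using s by (intro mult_left_mono) auto
      then have le: "(1 + 1 / s) * (hellinger d q q')\<^sup>2 \<le> (t - A) / 2" by (simp only: r2)
      have "(hellinger d q' p)\<^sup>2 \<le> (1 + s) * A + (1 + 1 / s) * (hellinger d q q')\<^sup>2"
        using hellinger_quasi_triangle[OF p q q' s] by (simp only: A_def hellinger_commute[of d p])
      also have "\<dots> < (t + A) / 2 + (t - A) / 2"
        by (rule add_less_le_mono[OF sA le])
      finally have "(hellinger d q' p)\<^sup>2 < t" by (simp add: field_simps)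
      then show ?thesis using q' by simp
    qed
    then show "\<exists>r>0. \<forall>q'\<in>densities d. L1_dist (lam d) q q' < r \<longrightarrow> q' \<in> ?B"
      using r by blast
  qed auto
  then show ?thesis
    unfolding density_space_def by (subst sets_measure_of) (auto simp: L1_open_def)
qed

section \<open>Change of measure and testing\<close>

lemma horizon_density_dominated:
  assumes z: "z \<in> Lam d" and m: "m \<ge> 1"
  shows "horizon_density d b z \<le> (horizon_density d c z + 2 / real m) *
    real m powr (if horizon_density d c z = 0 then 1 else 0)"
  \<comment> \<open>Where the density of \<open>c\<close> is 2 it dominates already. Where it
    vanishes, the floor \<open>2 / real m\<close> times \<open>real m\<close> is 2, so each
    misclassified point costs one factor \<open>real m\<close>.\<close>
  using horizon_density_values[OF z, of b] horizon_density_values[OF z, of c] m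
  by auto

lemma exp_le_two_powr:
  fixes x :: real
  assumes "x \<ge> 0"
  shows "exp x \<le> 2 powr (2 * x)"
proof -
  have "1 \<le> 2 * ln (2::real)" using ln2_ge_two_thirds by simp
  then have "x * 1 \<le> x * (2 * ln 2)" using assms by (rule mult_left_mono)
  then show ?thesis by (simp add: powr_def mult.assoc mult.left_commute)
qed

text \<open>The summand \<open>1/2\<close> bounds the probability that \<open>c\<close> misclassifies more than \<open>2 \<epsilon> m + 1\<close>
  sample points.\<close>

lemma iid_sample_change_of_measure:
  assumes b: "b \<in> continuous_boundaries (d - 1)" and c: "c \<in> continuous_boundaries (d - 1)"
    and d: "d \<ge> 1" and m: "m \<ge> 1"
    and close: "L1_dist (cube_measure (d - 1)) b c \<le> \<epsilon>"
    and D: "D \<in> sets (\<Pi>\<^sub>M i\<in>{1..m}. lam d)"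
  shows "emeasure (iid_sample d m (horizon_density d b)) D \<le> ennreal (1 / 2)
    + ennreal (real m powr (2 * \<epsilon> * real m + 1)) *
      emeasure (density (\<Pi>\<^sub>M i\<in>{1..m}. lam d)
        (\<lambda>S. \<Prod>i\<in>{1..m}. ennreal (horizon_density d c (S i) + 2 / real m))) D"
proof -
  let ?M = "\<Pi>\<^sub>M i\<in>{1..m}. lam d"
  let ?p = "horizon_density d b" and ?q = "horizon_density d c"
  let ?w = "\<lambda>z. ennreal (?q z + 2 / real m)"
  define r where "r = 2 * \<epsilon> * real m + 1"
  define X where "X z = (if ?q z = 0 then 1 else 0 :: real)" for z
  have \<epsilon>: "\<epsilon> \<ge> 0" using close L1_dist_nonneg order_trans by blast
  note [measurable] = horizon_density_measurable[OF b d] horizon_density_measurable[OF c d]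
  have p: "?p \<in> densities d" by (rule horizon_density_in_densities[OF b d])
  have [measurable]: "X \<in> borel_measurable (lam d)"
    unfolding X_def[abs_def] by measurable
  have [measurable]: "D \<in> sets ?M" by (rule D)
  have total: "(\<integral>\<^sup>+z. ennreal (?p z) \<partial>lam d) = 1"
    using p by (simp add: densities_def)
  \<comment> \<open>Markov's inequality in exponential form: if more than \<open>r\<close> points
    are misclassified, the first summand is at least 1.\<close>
  have pw: "indicator D S \<le> ennreal (2 powr (- r)) * (\<Prod>i\<in>{1..m}. ennreal (2 powr X (S i)))
      + (if (\<Sum>i\<in>{1..m}. X (S i)) \<le> r then 1 else 0) * indicator D S" for S
  proof (cases "(\<Sum>i\<in>{1..m}. X (S i)) \<le> r")
    case False
    then have "2 powr 0 \<le> 2 powr (- r + (\<Sum>i\<in>{1..m}. X (S i)))"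
      by (intro powr_mono) auto
    then have "1 \<le> 2 powr (- r) * (\<Prod>i\<in>{1..m}. 2 powr X (S i))"
      by (simp add: powr_diff powr_sum powr_minus divide_inverse mult.commute)
    then have "1 \<le> ennreal (2 powr (- r)) * (\<Prod>i\<in>{1..m}. ennreal (2 powr X (S i)))"
      by (subst prod_ennreal) (auto simp: ennreal_mult[symmetric] prod_nonneg)
    then show ?thesis by (auto simp: indicator_def)
  qed auto
  have "emeasure (iid_sample d m ?p) D = (\<integral>\<^sup>+S. indicator D S \<partial>iid_sample d m ?p)"
    by simp
  also have "\<dots> \<le> (\<integral>\<^sup>+S. ennreal (2 powr (- r)) * (\<Prod>i\<in>{1..m}. ennreal (2 powr X (S i)))
      + (if (\<Sum>i\<in>{1..m}. X (S i)) \<le> r then 1 else 0) * indicator D S \<partial>iid_sample d m ?p)"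
    by (intro nn_integral_mono pw)
  also have "\<dots> = ennreal (2 powr (- r)) * (\<integral>\<^sup>+S. (\<Prod>i\<in>{1..m}. ennreal (2 powr X (S i))) \<partial>iid_sample d m ?p)
      + (\<integral>\<^sup>+S. (if (\<Sum>i\<in>{1..m}. X (S i)) \<le> r then 1 else 0) * indicator D S \<partial>iid_sample d m ?p)"
    by (simp add: nn_integral_add nn_integral_cmult)
  also have "\<dots> \<le> ennreal (1 / 2) + ennreal (real m powr r) *
      emeasure (density ?M (\<lambda>S. \<Prod>i\<in>{1..m}. ?w (S i))) D"
  proof (rule add_mono)
    \<comment> \<open>A single observation contributes 1 plus the error probability of
      \<open>c\<close>, hence at most \<open>exp \<epsilon>\<close>.\<close>
    have "(\<integral>\<^sup>+z. ennreal (?p z) * ennreal (2 powr X z) \<partial>lam d)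
        = (\<integral>\<^sup>+z. ennreal (?p z) + ennreal (?p z) * (if ?q z = 0 then 1 else 0) \<partial>lam d)"
    proof (rule nn_integral_cong)
      fix z
      have "ennreal (2 powr X z) = 1 + (if ?q z = 0 then 1 else 0)"
        by (simp add: X_def)
      then show "ennreal (?p z) * ennreal (2 powr X z)
          = ennreal (?p z) + ennreal (?p z) * (if ?q z = 0 then 1 else 0)"
        by (simp only: distrib_left mult_1_right)
    qed
    also have "\<dots> = 1 + ennreal (L1_dist (cube_measure (d - 1)) b c)"
      by (subst nn_integral_add) (auto simp: total nn_integral_horizon_density_null[OF b c d])
    also have "\<dots> = ennreal (1 + L1_dist (cube_measure (d - 1)) b c)"
      by (subst ennreal_plus) (auto simp: L1_dist_nonneg)
    also have "\<dots> \<le> ennreal (exp \<epsilon>)"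
      using close exp_ge_add_one_self[of \<epsilon>] by (intro ennreal_leI) linarith
    finally have one: "(\<integral>\<^sup>+z. ennreal (?p z) * ennreal (2 powr X z) \<partial>lam d) \<le> ennreal (exp \<epsilon>)" .
    have "ennreal (2 powr (- r)) * (\<integral>\<^sup>+S. (\<Prod>i\<in>{1..m}. ennreal (2 powr X (S i))) \<partial>iid_sample d m ?p)
        \<le> ennreal (2 powr (- r)) * ennreal (exp \<epsilon>) ^ m"
      by (subst nn_integral_iid_sample_prod[OF p]) (auto intro!: mult_left_mono power_mono one)
    also have "\<dots> = ennreal (2 powr (- r) * exp (\<epsilon> * real m))"
      by (simp add: ennreal_power ennreal_mult exp_of_nat_mult[symmetric] mult.commute)
    \<comment> \<open>Passing to base 2 at most doubles the exponent, whence
      \<open>2 * \<epsilon> * real m\<close> in \<open>r\<close>; the summand 1 in \<open>r\<close>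
      leaves the value 1/2.\<close>
    also have "2 powr (- r) * exp (\<epsilon> * real m) \<le> 2 powr (- r) * 2 powr (2 * (\<epsilon> * real m))"
      using \<epsilon> by (intro mult_left_mono exp_le_two_powr) auto
    also have "\<dots> = 1 / 2"
      by (simp add: powr_add[symmetric] r_def powr_minus_divide)
    finally show "ennreal (2 powr (- r)) * (\<integral>\<^sup>+S. (\<Prod>i\<in>{1..m}. ennreal (2 powr X (S i))) \<partial>iid_sample d m ?p)
        \<le> ennreal (1 / 2)" by (simp add: ennreal_leI)
    have "(\<integral>\<^sup>+S. (if (\<Sum>i\<in>{1..m}. X (S i)) \<le> r then 1 else 0) * indicator D S \<partial>iid_sample d m ?p)
        = (\<integral>\<^sup>+S. (\<Prod>i\<in>{1..m}. ennreal (?p (S i))) *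
          ((if (\<Sum>i\<in>{1..m}. X (S i)) \<le> r then 1 else 0) * indicator D S) \<partial>?M)"
      unfolding iid_sample_density[OF p] by (rule nn_integral_density) measurable
    \<comment> \<open>With at most \<open>r\<close> errors in the sample, the pointwise domination
      costs at most \<open>real m powr r\<close> altogether.\<close>
    also have "\<dots> \<le> (\<integral>\<^sup>+S. ennreal (real m powr r) * ((\<Prod>i\<in>{1..m}. ?w (S i)) * indicator D S) \<partial>?M)"
    proof (rule nn_integral_mono)
      fix S assume S: "S \<in> space ?M"
      show "(\<Prod>i\<in>{1..m}. ennreal (?p (S i))) *
          ((if (\<Sum>i\<in>{1..m}. X (S i)) \<le> r then 1 else 0) * indicator D S)
        \<le> ennreal (real m powr r) * ((\<Prod>i\<in>{1..m}. ?w (S i)) * indicator D S)"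
      proof (cases "(\<Sum>i\<in>{1..m}. X (S i)) \<le> r \<and> S \<in> D")
        case True
        have Lam: "S i \<in> Lam d" if "i \<in> {1..m}" for i
          using S that by (auto simp: space_PiM space_lam)
        have nn: "0 \<le> ?q (S i) + 2 / real m" "0 \<le> ?p (S i)" if "i \<in> {1..m}" for i
          using horizon_density_values[OF Lam[OF that], of b] horizon_density_values[OF Lam[OF that], of c]
          by auto
        have "(\<Prod>i\<in>{1..m}. ?p (S i)) \<le> (\<Prod>i\<in>{1..m}. (?q (S i) + 2 / real m) * real m powr X (S i))"
          using horizon_density_dominated[OF Lam m, of _ b c] nn
          by (intro prod_mono) (auto simp: X_def)
        also have "\<dots> = (\<Prod>i\<in>{1..m}. ?q (S i) + 2 / real m) * real m powr (\<Sum>i\<in>{1..m}. X (S i))"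
          using m by (simp add: prod.distrib powr_sum)
        also have "\<dots> \<le> (\<Prod>i\<in>{1..m}. ?q (S i) + 2 / real m) * real m powr r"
          using True m nn by (intro mult_left_mono powr_mono prod_nonneg) auto
        finally have "ennreal (\<Prod>i\<in>{1..m}. ?p (S i))
            \<le> ennreal (real m powr r) * ennreal (\<Prod>i\<in>{1..m}. ?q (S i) + 2 / real m)"
          using nn by (subst ennreal_mult[symmetric]) (auto intro!: ennreal_leI prod_nonneg simp: mult.commute)
        then show ?thesis
          using True nn by (subst (1 2) prod_ennreal) auto
      qed auto
    qed
    also have "\<dots> = ennreal (real m powr r) * emeasure (density ?M (\<lambda>S. \<Prod>i\<in>{1..m}. ?w (S i))) D"
      by (subst emeasure_density, measurable, subst nn_integral_cmult, measurable)
    finally show "(\<integral>\<^sup>+S. (if (\<Sum>i\<in>{1..m}. X (S i)) \<le> r then 1 else 0) * indicator D S \<partial>iid_sample d m ?p)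
      \<le> ennreal (real m powr r) * emeasure (density ?M (\<lambda>S. \<Prod>i\<in>{1..m}. ?w (S i))) D" .
  qed
  finally show ?thesis by (simp add: r_def)
qed

text \<open>Each observation contributes the mass \<open>1 + 2 / real m\<close>, at most
  \<open>exp (2 / real m)\<close>. A floor of order \<open>1 / real m\<close> therefore keeps the
  mass of the whole sample bounded.\<close>

lemma smoothed_likelihood_mass:
  assumes c: "c \<in> continuous_boundaries (d - 1)" and d: "d \<ge> 1" and m: "m \<ge> 1"
  shows "emeasure (density (\<Pi>\<^sub>M i\<in>{1..m}. lam d)
        (\<lambda>S. \<Prod>i\<in>{1..m}. ennreal (horizon_density d c (S i) + 2 / real m))) (space (\<Pi>\<^sub>M i\<in>{1..m}. lam d))
    \<le> ennreal (exp 2)"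
proof -
  let ?M = "\<Pi>\<^sub>M i\<in>{1..m}. lam d"
  let ?q = "horizon_density d c"
  interpret L: product_sigma_finite "\<lambda>_::nat. lam d" by (rule product_sigma_finite_lam)
  interpret lam: prob_space "lam d" by (rule prob_space_lam)
  note [measurable] = horizon_density_measurable[OF c d]
  have total: "(\<integral>\<^sup>+z. ennreal (?q z) \<partial>lam d) = 1"
    using horizon_density_in_densities[OF c d] by (simp add: densities_def)
  have "(\<integral>\<^sup>+z. ennreal (?q z + 2 / real m) \<partial>lam d) = (\<integral>\<^sup>+z. ennreal (?q z) + ennreal (2 / real m) \<partial>lam d)"
    using horizon_density_values[of _ d c]
    by (intro nn_integral_cong ennreal_plus) (force simp: space_lam)+
  also have "\<dots> = ennreal (1 + 2 / real m)"
    by (simp add: nn_integral_add total lam.emeasure_space_1 ennreal_plus)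
  finally have one: "(\<integral>\<^sup>+z. ennreal (?q z + 2 / real m) \<partial>lam d) = ennreal (1 + 2 / real m)" .
  have "emeasure (density ?M (\<lambda>S. \<Prod>i\<in>{1..m}. ennreal (?q (S i) + 2 / real m))) (space ?M)
      = (\<integral>\<^sup>+S. (\<Prod>i\<in>{1..m}. ennreal (?q (S i) + 2 / real m)) * indicator (space ?M) S \<partial>?M)"
    by (rule emeasure_density) auto
  also have "\<dots> = (\<integral>\<^sup>+S. (\<Prod>i\<in>{1..m}. ennreal (?q (S i) + 2 / real m)) \<partial>?M)"
    by (intro nn_integral_cong) auto
  also have "\<dots> = ennreal ((1 + 2 / real m) ^ m)"
    by (subst L.product_nn_integral_prod) (auto simp: one ennreal_power simp del: ennreal_plus)
  also have "(1 + 2 / real m) ^ m \<le> exp (2 / real m) ^ m"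
    by (intro power_mono exp_ge_add_one_self) auto
  also have "\<dots> = exp 2"
    using m by (simp add: exp_of_nat_mult[symmetric])
  finally show ?thesis by (simp add: ennreal_leI)
qed

text \<open>An estimator yields a test: decide for \<open>j\<close> if the estimate lies in a
  Hellinger ball around the density of \<open>f j\<close>. The balls are disjoint, so the change of
  measure and \<open>large\<close> bound the sum of the success probabilities by 3/4 of
  \<open>M\<close>. Hence for some \<open>j\<close> the test fails with probability at least 1/4,
  and a failure costs at least \<open>\<delta> / 2\<close>.\<close>

theorem packing_risk_lower_bound:
  fixes f g :: "nat \<Rightarrow> (nat \<Rightarrow> real) \<Rightarrow> real"
  assumes f: "\<And>j. j < M \<Longrightarrow> f j \<in> continuous_boundaries (d - 1)"
    and g: "\<And>k. k < N \<Longrightarrow> g k \<in> continuous_boundaries (d - 1)"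
    and d: "d \<ge> 1" and m: "m \<ge> 1" and M: "M > 0"
    and packing: "\<And>i j. i < M \<Longrightarrow> j < M \<Longrightarrow> i \<noteq> j \<Longrightarrow> \<delta> < L1_dist (cube_measure (d - 1)) (f i) (f j)"
    and cover: "\<And>j. j < M \<Longrightarrow> \<exists>k<N. L1_dist (cube_measure (d - 1)) (f j) (g k) \<le> \<epsilon>"
    and large: "4 * (real m powr (2 * \<epsilon> * real m + 1) * (real N * exp 2)) \<le> real M"
    and \<delta>: "\<delta> \<ge> 0"
    and E: "E \<in> estimators d m"
  shows "\<exists>j<M. ennreal (\<delta> / 8) \<le>
    (\<integral>\<^sup>+S. ennreal ((hellinger d (E S) (horizon_density d (f j)))\<^sup>2) \<partial>iid_sample d m (horizon_density d (f j)))"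
proof -
  let ?M = "\<Pi>\<^sub>M i\<in>{1..m}. lam d"
  let ?p = "\<lambda>j. horizon_density d (f j)"
  let ?R = "ennreal (real m powr (2 * \<epsilon> * real m + 1))"
  \<comment> \<open>The squared radius \<open>\<delta> / 2\<close> makes the balls disjoint: a
    common point would put the centers at squared distance below \<open>2 * \<delta>\<close>, while
    the packing gives more than that.\<close>
  define B where "B j = {q \<in> densities d. (hellinger d q (?p j))\<^sup>2 < \<delta> / 2}" for j
  define D where "D j = E -` B j \<inter> space ?M" for j
  define Q where "Q k = density ?M (\<lambda>S. \<Prod>i\<in>{1..m}. ennreal (horizon_density d (g k) (S i) + 2 / real m))" for k
  have p: "?p j \<in> densities d" if "j < M" for j
    using horizon_density_in_densities[OF f[OF that] d] .
  have E': "E \<in> ?M \<rightarrow>\<^sub>M density_space d"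
    using E by (simp add: estimators_def)
  have D: "D j \<in> sets ?M" if "j < M" for j
    unfolding D_def B_def by (rule measurable_sets[OF E' hellinger_ball_measurable[OF p[OF that]]])
  have DQ: "D j \<in> sets (Q k)" if "j < M" for j k
    using D[OF that] by (simp add: Q_def)
  have disj: "disjoint_family_on D {..<M}"
  proof -
    have False if ij: "i < M" "j < M" "i \<noteq> j" and q: "q \<in> B i" "q \<in> B j" for i j q
    proof -
      have "2 * L1_dist (cube_measure (d - 1)) (f i) (f j) = (hellinger d (?p i) (?p j))\<^sup>2"
        by (rule hellinger_horizon_density[OF f[OF ij(1)] f[OF ij(2)] d, symmetric])
      also have "\<dots> \<le> (1 + 1) * (hellinger d (?p i) q)\<^sup>2 + (1 + 1 / 1) * (hellinger d q (?p j))\<^sup>2"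
        using q ij by (intro hellinger_quasi_triangle p) (auto simp: B_def)
      also have "\<dots> < 2 * \<delta>"
        using q by (simp add: B_def hellinger_commute[of d "?p i"])
      finally show False using packing[OF ij] by simp
    qed
    note disj_B = this
    show ?thesis
      unfolding disjoint_family_on_def
    proof (intro ballI impI)
      fix i j assume "i \<in> {..<M}" "j \<in> {..<M}" "i \<noteq> j"
      then show "D i \<inter> D j = {}" using disj_B[of i j] unfolding D_def by blast
    qed
  qed
  have "(\<Sum>j<M. emeasure (iid_sample d m (?p j)) (D j))
      \<le> (\<Sum>j<M. ennreal (1 / 2) + ?R * (\<Sum>k<N. emeasure (Q k) (D j)))"
  proof (rule sum_mono)
    fix j assume "j \<in> {..<M}"
    then have j: "j < M" by simp
    obtain k where k: "k < N" "L1_dist (cube_measure (d - 1)) (f j) (g k) \<le> \<epsilon>"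
      using cover[OF j] by auto
    have "emeasure (iid_sample d m (?p j)) (D j) \<le> ennreal (1 / 2) + ?R * emeasure (Q k) (D j)"
      unfolding Q_def by (rule iid_sample_change_of_measure[OF f[OF j] g[OF k(1)] d m k(2) D[OF j]])
    \<comment> \<open>Summing over all \<open>k\<close> removes the dependence on the cover element
      chosen for \<open>j\<close>; the sums can then be exchanged and disjointness used under each
      fixed \<open>Q k\<close>.\<close>
    also have "emeasure (Q k) (D j) \<le> (\<Sum>k<N. emeasure (Q k) (D j))"
      using k by (intro member_le_sum) auto
    finally show "emeasure (iid_sample d m (?p j)) (D j)
      \<le> ennreal (1 / 2) + ?R * (\<Sum>k<N. emeasure (Q k) (D j))"
      by (simp add: mult_left_mono add_left_mono)
  qed
  also have "\<dots> = of_nat M * ennreal (1 / 2) + ?R * (\<Sum>k<N. \<Sum>j<M. emeasure (Q k) (D j))"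
    by (simp add: sum.distrib sum_distrib_left[symmetric] sum.swap[of _ "{..<N}"])
  also have "(\<Sum>k<N. \<Sum>j<M. emeasure (Q k) (D j)) \<le> (\<Sum>k<N. ennreal (exp 2))"
  proof (rule sum_mono)
    fix k assume k: "k \<in> {..<N}"
    have "(\<Sum>j<M. emeasure (Q k) (D j)) = emeasure (Q k) (\<Union>j<M. D j)"
      using DQ disj by (intro sum_emeasure) auto
    also have "\<dots> \<le> emeasure (Q k) (space ?M)"
      by (intro emeasure_mono) (auto simp: D_def Q_def)
    also have "\<dots> \<le> ennreal (exp 2)"
      unfolding Q_def using k by (intro smoothed_likelihood_mass g d m) auto
    finally show "(\<Sum>j<M. emeasure (Q k) (D j)) \<le> ennreal (exp 2)" .
  qed
  also have "of_nat M * ennreal (1 / 2) + ?R * (\<Sum>k<N. ennreal (exp 2))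
      = ennreal (real M / 2 + real m powr (2 * \<epsilon> * real m + 1) * (real N * exp 2))"
  proof -
    have "of_nat M * ennreal (1 / 2) = ennreal (real M / 2)"
      by (subst ennreal_of_nat_eq_real_of_nat, subst ennreal_mult[symmetric]) auto
    moreover have "?R * (\<Sum>k<N. ennreal (exp 2)) = ennreal (real m powr (2 * \<epsilon> * real m + 1) * (real N * exp 2))"
      by (simp add: ennreal_mult[symmetric] ennreal_of_nat_eq_real_of_nat)
    ultimately show ?thesis
      by (subst ennreal_plus) auto
  qed
  also have "\<dots> \<le> ennreal (3 / 4 * real M)"
    using large by (intro ennreal_leI) simp
  finally have sum: "(\<Sum>j<M. emeasure (iid_sample d m (?p j)) (D j)) \<le> ennreal (3 / 4 * real M)"
    by (simp add: add_left_mono mult_left_mono)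
  have "\<exists>j<M. measure (iid_sample d m (?p j)) (D j) \<le> 3 / 4"
  proof (rule ccontr)
    assume "\<not> ?thesis"
    then have less: "3 / 4 < measure (iid_sample d m (?p j)) (D j)" if "j < M" for j
      using that by (auto simp: not_le)
    have em: "emeasure (iid_sample d m (?p j)) (D j) = ennreal (measure (iid_sample d m (?p j)) (D j))" if "j < M" for j
      using prob_space_iid_sample[OF p[OF that]]
      by (simp add: prob_space.axioms(1) finite_measure.emeasure_eq_measure prob_space_def)
    have "3 / 4 * real M = (\<Sum>j<M. 3 / 4)" by simp
    also have "\<dots> < (\<Sum>j<M. measure (iid_sample d m (?p j)) (D j))"
      using less M by (intro sum_strict_mono) auto
    finally have lt: "3 / 4 * real M < (\<Sum>j<M. measure (iid_sample d m (?p j)) (D j))" .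
    have "(\<Sum>j<M. emeasure (iid_sample d m (?p j)) (D j))
        = ennreal (\<Sum>j<M. measure (iid_sample d m (?p j)) (D j))"
      using em by (subst sum_ennreal[symmetric]) auto
    with sum have "ennreal (\<Sum>j<M. measure (iid_sample d m (?p j)) (D j)) \<le> ennreal (3 / 4 * real M)"
      by simp
    with lt show False by (subst (asm) ennreal_le_iff) auto
  qed
  then obtain j where j: "j < M" and small: "measure (iid_sample d m (?p j)) (D j) \<le> 3 / 4" by auto
  interpret P: prob_space "iid_sample d m (?p j)" by (rule prob_space_iid_sample[OF p[OF j]])
  have sp: "space (iid_sample d m (?p j)) = space ?M"
    by (rule sets_eq_imp_space_eq[OF sets_iid_sample])
  have Dj: "D j \<in> P.events" using D[OF j] by (simp add: sets_iid_sample)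
  have "ennreal (\<delta> / 8) \<le> ennreal (\<delta> / 2 * P.prob (space ?M - D j))"
    using P.prob_compl[OF Dj] small \<delta> sp
    by (intro ennreal_leI) (auto simp: mult_left_mono[of "1 / 4" "1 - P.prob (D j)" "\<delta> / 2", simplified])
  also have "\<dots> = (\<integral>\<^sup>+S. ennreal (\<delta> / 2) * indicator (space ?M - D j) S \<partial>iid_sample d m (?p j))"
    using sets.compl_sets[OF Dj] \<delta> unfolding sp
    by (subst nn_integral_cmult_indicator) (simp_all add: P.emeasure_eq_measure ennreal_mult[symmetric])
  also have "\<dots> \<le> (\<integral>\<^sup>+S. ennreal ((hellinger d (E S) (?p j))\<^sup>2) \<partial>iid_sample d m (?p j))"
  proof (rule nn_integral_mono)
    fix S assume "S \<in> space (iid_sample d m (?p j))"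
    then have "S \<in> space ?M" by (simp add: sp)
    moreover from this have "E S \<in> densities d"
      using measurable_space[OF E'] by (simp add: space_density_space)
    ultimately show "ennreal (\<delta> / 2) * indicator (space ?M - D j) S \<le> ennreal ((hellinger d (E S) (?p j))\<^sup>2)"
      by (auto simp: indicator_def D_def B_def not_less intro!: ennreal_leI)
  qed
  finally show ?thesis using j by blast
qed

subsection \<open>Packing entropy and growth rates\<close>

text \<open>Finite entropy bounds the size of finite packings, so a largest one exists. Singletons
  are packings, so it is nonempty and the logarithm is that of a positive number.\<close>

lemma packing_entropy_attained:
  assumes "K \<noteq> {}" and fin: "packing_entropy K dst \<epsilon> < \<infinity>"
  obtains N where "finite N" "N \<noteq> {}" "is_packing K dst \<epsilon> N"
    "packing_entropy K dst \<epsilon> = ereal (ln (real (card N)))"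
    "\<And>N'. finite N' \<Longrightarrow> is_packing K dst \<epsilon> N' \<Longrightarrow> card N' \<le> card N"
proof -
  obtain x where x: "x \<in> K" using assms by auto
  let ?A = "{N. is_packing K dst \<epsilon> N \<and> finite N}"
  have sing: "{x} \<in> ?A" using x by (auto simp: is_packing_def)
  obtain n where n: "packing_number K dst \<epsilon> = enat n"
    using fin by (cases "packing_number K dst \<epsilon>") (auto simp: packing_entropy_def)
  have le: "card N \<le> n" if "N \<in> ?A" for N
  proof -
    have "enat (card N) \<le> packing_number K dst \<epsilon>"
      unfolding packing_number_def using that by (intro SUP_upper)
    then show ?thesis by (simp add: n)
  qed
  obtain N where N: "N \<in> ?A" "\<forall>N'. N' \<in> ?A \<longrightarrow> card N' \<le> card N"
    using ex_has_greatest_nat[of "\<lambda>N. N \<in> ?A" "{x}" card "Suc n"] sing le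
    by (auto simp: less_Suc_eq_le)
  have "packing_number K dst \<epsilon> = enat (card N)"
    unfolding packing_number_def using N by (intro antisym SUP_least SUP_upper) auto
  then have ent: "packing_entropy K dst \<epsilon> = ereal (ln (real (card N)))"
    by (simp add: packing_entropy_def)
  have "N \<noteq> {}" using N(2)[rule_format, OF sing] by auto
  then show thesis using N ent by (intro that[of N]) auto
qed

text \<open>A point farther than \<open>\<epsilon>\<close> from all of \<open>N\<close> would be new
  and could be added to \<open>N\<close>, against maximality.\<close>

lemma maximal_packing_covers:
  assumes N: "finite N" "is_packing K dst \<epsilon> N"
    and max: "\<And>N'. finite N' \<Longrightarrow> is_packing K dst \<epsilon> N' \<Longrightarrow> card N' \<le> card N"
    and sym: "\<And>x y. dst x y = dst y x" and zero: "\<And>x. dst x x \<le> \<epsilon>" and x: "x \<in> K"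
  shows "\<exists>y\<in>N. dst x y \<le> \<epsilon>"
proof (rule ccontr)
  assume "\<not> ?thesis"
  then have far: "\<And>y. y \<in> N \<Longrightarrow> dst x y > \<epsilon>" by (auto simp: not_le)
  then have "x \<notin> N" using zero[of x] by force
  moreover have "is_packing K dst \<epsilon> (insert x N)"
    using N(2) far sym x unfolding is_packing_def by (metis insert_iff insert_subset)
  ultimately show False using max[of "insert x N"] N(1) by simp
qed

section \<open>Powers of \<open>m\<close> and of \<open>ln (2 * real m)\<close>\<close>

lemma ln_double_ge: "m \<ge> 1 \<Longrightarrow> ln 2 \<le> ln (2 * real m)"
  by simp

lemma ln_double_pos: "m \<ge> 1 \<Longrightarrow> 0 < ln (2 * real m)"
  by simp

text \<open>The logarithm is bounded below by \<open>ln 2\<close> and not by 1, so raising the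
  exponent costs a constant, attained at \<open>m = 1\<close>.\<close>

lemma ln_double_powr_antimono:
  assumes "p \<le> q"
  obtains C where "C > 0" "\<And>m::nat. m \<ge> 1 \<Longrightarrow> ln (2 * real m) powr p \<le> C * ln (2 * real m) powr q"
proof (rule that[of "ln 2 powr (p - q)"])
  fix m :: nat assume m: "m \<ge> 1"
  have "ln (2 * real m) powr (p - q) \<le> ln 2 powr (p - q)"
    using assms m by (intro powr_mono2') auto
  then have "ln (2 * real m) powr (p - q) * ln (2 * real m) powr q \<le> ln 2 powr (p - q) * ln (2 * real m) powr q"
    by (rule mult_right_mono) simp
  then show "ln (2 * real m) powr p \<le> ln 2 powr (p - q) * ln (2 * real m) powr q"
    using ln_double_pos[OF m] by (simp flip: powr_add)
qed simp

lemma ln_double_powr_le_powr: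
  assumes "s > 0"
  obtains C where "C > 0" "\<And>m::nat. m \<ge> 1 \<Longrightarrow> ln (2 * real m) powr p \<le> C * real m powr s"
proof -
  \<comment> \<open>The exponent \<open>p\<close> may be zero or negative; \<open>p'\<close> makes
    \<open>t = s / p'\<close> positive for \<open>ln_powr_bound\<close>.\<close>
  define p' where "p' = max p 1"
  have p': "p' > 0" "p \<le> p'" by (auto simp: p'_def)
  obtain C where C: "C > 0" "\<And>m::nat. m \<ge> 1 \<Longrightarrow> ln (2 * real m) powr p \<le> C * ln (2 * real m) powr p'"
    using ln_double_powr_antimono[OF p'(2)] by metis
  define t where "t = s / p'"
  have t: "t > 0" using assms p' by (simp add: t_def)
  show thesis
  proof (rule that[of "C * (2 powr s / t powr p')"])
    show "C * (2 powr s / t powr p') > 0" using C t by simp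
    fix m :: nat assume m: "m \<ge> 1"
    have "ln (2 * real m) \<le> (2 * real m) powr t / t"
      using m t by (intro ln_powr_bound) auto
    then have "ln (2 * real m) powr p' \<le> ((2 * real m) powr t / t) powr p'"
      using ln_double_pos[OF m] p' by (intro powr_mono2) auto
    also have "\<dots> = 2 powr s / t powr p' * real m powr s"
      using t p' by (simp add: powr_divide powr_powr t_def powr_mult)
    finally have "C * ln (2 * real m) powr p' \<le> C * (2 powr s / t powr p' * real m powr s)"
      by (rule mult_left_mono) (use C in simp)
    with C(2)[OF m] show "ln (2 * real m) powr p \<le> C * (2 powr s / t powr p') * real m powr s"
      by (simp add: mult.assoc)
  qed
qed

text \<open>Applied to the reciprocal of a scale, which grows at most polynomially in
  \<open>m\<close>, this replaces the logarithm in the entropy bounds by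
  \<open>ln (2 * real m)\<close>.\<close>

lemma ln_two_plus_le:
  assumes "A \<ge> 0" "q \<ge> 0" and m: "(m::nat) \<ge> 1" and x: "0 \<le> x" "x \<le> A * real m powr q"
  shows "ln (2 + x) \<le> (ln (2 + A) / ln 2 + q) * ln (2 * real m)"
proof -
  have 1: "1 \<le> real m powr q" "real m powr q \<le> (2 * real m) powr q"
    using m assms by (auto intro!: ge_one_powr_ge_zero powr_mono2)
  have "2 + x \<le> 2 * real m powr q + A * real m powr q" using x 1 by linarith
  also have "\<dots> = (2 + A) * real m powr q" by (simp add: algebra_simps)
  also have "\<dots> \<le> (2 + A) * (2 * real m) powr q" using 1 assms by (intro mult_left_mono) auto
  finally have "ln (2 + x) \<le> ln ((2 + A) * (2 * real m) powr q)"
    using x m assms by (subst ln_le_cancel_iff) auto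
  also have "\<dots> = ln (2 + A) + q * ln (2 * real m)"
    using m assms by (simp add: ln_mult ln_powr)
  also have "ln (2 + A) \<le> ln (2 + A) / ln 2 * ln (2 * real m)"
  proof -
    have "ln (2 + A) / ln 2 * ln 2 \<le> ln (2 + A) / ln 2 * ln (2 * real m)"
      using assms ln_double_ge[OF m] by (intro mult_left_mono divide_nonneg_nonneg) auto
    then show ?thesis by simp
  qed
  finally show ?thesis by (simp add: algebra_simps)
qed

text \<open>This is \<open>ln y \<le> y\<close> at \<open>y = x / \<beta>\<close>, exponentiated. It
  turns the exponential tail of the upper bound into the power of \<open>m\<close> in the
  rate.\<close>

lemma exp_minus_le_powr:
  assumes \<beta>: "\<beta> > 0" and x: "(x::real) > 0"
  shows "exp (- x) \<le> \<beta> powr \<beta> * x powr (- \<beta>)"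
proof -
  have "ln (x / \<beta>) \<le> x / \<beta>" using assms ln_bound[of "x / \<beta>"] by simp
  then have "\<beta> * ln (x / \<beta>) \<le> x" using \<beta> by (simp add: field_simps)
  then have "exp (\<beta> * ln (x / \<beta>)) \<le> exp x" by simp
  then have "(x / \<beta>) powr \<beta> \<le> exp x" using assms by (simp add: powr_def)
  then have "x powr \<beta> / \<beta> powr \<beta> \<le> exp x" using assms by (simp add: powr_divide)
  then show ?thesis using assms by (simp add: exp_minus powr_minus field_simps)
qed

lemma powr_scale:
  assumes "\<kappa> > 0" "m \<ge> 1"
  shows "(\<kappa> * (real m powr u * ln (2 * real m) powr v)) powr w
    = \<kappa> powr w * (real m powr (u * w) * ln (2 * real m) powr (v * w))"
  using assms by (simp add: powr_mult powr_powr)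

lemma inverse_scale_le:
  assumes \<kappa>: "\<kappa> > 0"
  obtains A where "A > 0"
    "\<And>m::nat. m \<ge> 1 \<Longrightarrow> 1 / (\<kappa> * (real m powr (- s) * ln (2 * real m) powr p)) \<le> A / \<kappa> * real m powr (s + 1)"
proof -
  obtain A where A: "A > 0" "\<And>m::nat. m \<ge> 1 \<Longrightarrow> ln (2 * real m) powr (- p) \<le> A * real m powr 1"
    using ln_double_powr_le_powr[of 1 "- p"] by auto
  have "1 / (\<kappa> * (real m powr (- s) * ln (2 * real m) powr p)) \<le> A / \<kappa> * real m powr (s + 1)"
    if m: "m \<ge> 1" for m :: nat
  proof -
    have "1 / (\<kappa> * (real m powr (- s) * ln (2 * real m) powr p))
        = 1 / \<kappa> * real m powr s * ln (2 * real m) powr (- p)"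
      by (simp add: powr_minus_divide)
    also have "\<dots> \<le> 1 / \<kappa> * real m powr s * (A * real m powr 1)"
      using A(2)[OF m] \<kappa> by (intro mult_left_mono) auto
    also have "\<dots> = A / \<kappa> * real m powr (s + 1)"
      using m by (simp add: powr_add)
    finally show ?thesis .
  qed
  then show thesis using A(1) that by blast
qed

text \<open>The exponent \<open>\<beta> / (\<beta> + 1)\<close> balances sample size and entropy: at
  this scale \<open>\<epsilon>\<close>, both \<open>\<epsilon> * real m\<close> and
  \<open>\<epsilon> powr (- 1 / \<beta>)\<close> carry the power \<open>1 / (\<beta> + 1)\<close> of
  \<open>m\<close>. The exponent \<open>p\<close> stays free because the two risk bounds take
  different ones.\<close>

lemma entropy_upper_at_scale:
  assumes \<kappa>: "\<kappa> > 0" and c: "c > 0" and \<beta>: "\<beta> > 0" and b: "b \<ge> 0"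
  obtains C where "C > 0"
    "\<And>m::nat. m \<ge> 1 \<Longrightarrow>
       c * ((\<kappa> * (real m powr (- (\<beta> / (\<beta> + 1))) * ln (2 * real m) powr p)) powr (- 1 / \<beta>) *
         ln (2 + 1 / (\<kappa> * (real m powr (- (\<beta> / (\<beta> + 1))) * ln (2 * real m) powr p))) powr b)
       \<le> C * (real m powr (1 / (\<beta> + 1)) * ln (2 * real m) powr (b - p / \<beta>))"
proof -
  let ?s = "\<beta> / (\<beta> + 1)"
  let ?e = "\<lambda>m. \<kappa> * (real m powr (- ?s) * ln (2 * real m) powr p)"
  have s: "?s \<ge> 0" using \<beta> by simp
  obtain A where A: "A > 0" "\<And>m::nat. m \<ge> 1 \<Longrightarrow> 1 / ?e m \<le> A / \<kappa> * real m powr (?s + 1)"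
    using inverse_scale_le[OF \<kappa>, of ?s p] by metis
  define B where "B = ln (2 + A / \<kappa>) / ln 2 + (?s + 1)"
  have "ln (2 + A / \<kappa>) / ln 2 \<ge> 0"
    using A \<kappa> by (intro divide_nonneg_nonneg ln_ge_zero) auto
  then have B: "B > 0" unfolding B_def using s by linarith
  show thesis
  proof (rule that[of "c * (\<kappa> powr (- 1 / \<beta>) * B powr b)"])
    show "c * (\<kappa> powr (- 1 / \<beta>) * B powr b) > 0" using c \<kappa> B by simp
    fix m :: nat assume m: "m \<ge> 1"
    have L: "ln (2 * real m) > 0" by (rule ln_double_pos[OF m])
    have e: "?e m > 0" using m \<kappa> L by simp
    have "ln (2 + 1 / ?e m) \<le> B * ln (2 * real m)"
      unfolding B_def using A m e \<kappa> s by (intro ln_two_plus_le) auto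
    then have "ln (2 + 1 / ?e m) powr b \<le> (B * ln (2 * real m)) powr b"
      using b e by (intro powr_mono2) auto
    also have "\<dots> = B powr b * ln (2 * real m) powr b"
      using B L by (simp add: powr_mult)
    finally have 1: "ln (2 + 1 / ?e m) powr b \<le> B powr b * ln (2 * real m) powr b" .
    have "- ?s * (- 1 / \<beta>) = 1 / (\<beta> + 1)" using \<beta> by (simp add: field_simps)
    then have 2: "?e m powr (- 1 / \<beta>)
        = \<kappa> powr (- 1 / \<beta>) * (real m powr (1 / (\<beta> + 1)) * ln (2 * real m) powr (- p / \<beta>))"
      using powr_scale[OF \<kappa> m, of "- ?s" p "- 1 / \<beta>"] by simp
    have "c * (?e m powr (- 1 / \<beta>) * ln (2 + 1 / ?e m) powr b)
        \<le> c * (\<kappa> powr (- 1 / \<beta>) * (real m powr (1 / (\<beta> + 1)) * ln (2 * real m) powr (- p / \<beta>))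
             * (B powr b * ln (2 * real m) powr b))"
      unfolding 2 using c by (intro mult_left_mono 1) auto
    also have "\<dots> = c * (\<kappa> powr (- 1 / \<beta>) * B powr b) *
        (real m powr (1 / (\<beta> + 1)) * (ln (2 * real m) powr (- p / \<beta>) * ln (2 * real m) powr b))"
      by (simp add: ac_simps)
    also have "ln (2 * real m) powr (- p / \<beta>) * ln (2 * real m) powr b = ln (2 * real m) powr (b - p / \<beta>)"
      using L by (simp flip: powr_add)
    finally show "c * (?e m powr (- 1 / \<beta>) * ln (2 + 1 / ?e m) powr b)
       \<le> c * (\<kappa> powr (- 1 / \<beta>) * B powr b) * (real m powr (1 / (\<beta> + 1)) * ln (2 * real m) powr (b - p / \<beta>))" .
  qed
qed

text \<open>A power of \<open>1 / k\<close> outgrows a power of its logarithm. The lower bound uses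
  this to choose the prefactor of its packing scale.\<close>

lemma powr_div_ln_at_top:
  fixes c A \<alpha> a B :: real
  assumes "c > 0" "A > 0" "\<alpha> > 0" "a \<ge> 0" "B > 0"
  shows "filterlim (\<lambda>k. c * (k powr (- 1 / \<alpha>) / (ln (2 + A / k) / ln 2 + B) powr a)) at_top (at_right 0)"
  using assms by real_asymp

subsection \<open>Minimax rates\<close>

text \<open>One maximal packing is both a separated family and a cover, with the entropy as the
  logarithm of its size.\<close>

lemma finite_cover_enumeration:
  assumes K: "K \<noteq> {}" and fin: "packing_entropy K (L1_dist M) \<epsilon> \<le> ereal x" and \<epsilon>: "\<epsilon> \<ge> 0"
  obtains f and n :: nat where "n > 0" "\<And>j. j < n \<Longrightarrow> f j \<in> K"
    "packing_entropy K (L1_dist M) \<epsilon> = ereal (ln (real n))"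
    "\<And>i j. i < n \<Longrightarrow> j < n \<Longrightarrow> i \<noteq> j \<Longrightarrow> \<epsilon> < L1_dist M (f i) (f j)"
    "\<And>b. b \<in> K \<Longrightarrow> \<exists>j<n. L1_dist M b (f j) \<le> \<epsilon>"
proof -
  have "packing_entropy K (L1_dist M) \<epsilon> < \<infinity>" using fin by (cases "packing_entropy K (L1_dist M) \<epsilon>") auto
  from packing_entropy_attained[OF K this] obtain N where N: "finite N" "N \<noteq> {}" "is_packing K (L1_dist M) \<epsilon> N"
    "packing_entropy K (L1_dist M) \<epsilon> = ereal (ln (real (card N)))"
    "\<And>N'. finite N' \<Longrightarrow> is_packing K (L1_dist M) \<epsilon> N' \<Longrightarrow> card N' \<le> card N" by metis
  obtain f where f: "bij_betw f {0..<card N} N"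
    using ex_bij_betw_nat_finite[OF N(1)] by auto
  have fN: "f j \<in> N" if "j < card N" for j
    using f that by (auto simp: bij_betw_def)
  have inj: "f i \<noteq> f j" if "i < card N" "j < card N" "i \<noteq> j" for i j
    using f that by (auto simp: bij_betw_def inj_on_def)
  show thesis
  proof (rule that[of "card N" f])
    show "card N > 0" using N by (simp add: card_gt_0_iff)
    show "f j \<in> K" if "j < card N" for j
      using fN[OF that] N(3) by (auto simp: is_packing_def)
    show "packing_entropy K (L1_dist M) \<epsilon> = ereal (ln (real (card N)))" by (rule N)
    show "\<epsilon> < L1_dist M (f i) (f j)" if "i < card N" "j < card N" "i \<noteq> j" for i j
      using N(3) fN inj that by (simp add: is_packing_def)
    fix b assume "b \<in> K"
    moreover have "L1_dist M x x \<le> \<epsilon>" for x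
      using \<epsilon> by (simp add: L1_dist_def)
    ultimately obtain c where c: "c \<in> N" "L1_dist M b c \<le> \<epsilon>"
      using maximal_packing_covers[OF N(1,3,5) L1_dist_commute] by metis
    have "c \<in> f ` {0..<card N}" using f c by (simp add: bij_betw_def)
    then obtain j where "j < card N" "f j = c" by auto
    then show "\<exists>j<card N. L1_dist M b (f j) \<le> \<epsilon>" using c by auto
  qed
qed

text \<open>The cover scale \<open>\<epsilon>\<close> is a constant times the claimed rate. At this
  scale the entropy is at most a constant times \<open>\<epsilon> * real m\<close>, so a large
  \<open>K\<close> also brings the union bound down to the rate.\<close>

theorem horizon_risk_upper_bound:
  fixes \<beta> b :: real
  assumes d: "d \<ge> 1"
    and C: "\<C> \<subseteq> continuous_boundaries (d - 1)" "\<C> \<noteq> {}"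
    and \<beta>: "\<beta> > 0" and b: "b \<ge> 0" and c: "c > 0"
    and entropy: "\<And>\<epsilon>. 0 < \<epsilon> \<Longrightarrow> \<epsilon> < 1 \<Longrightarrow>
      packing_entropy \<C> (L1_dist (cube_measure (d - 1))) \<epsilon>
        \<le> ereal (c * (\<epsilon> powr (- 1 / \<beta>) * ln (2 + 1 / \<epsilon>) powr b))"
  obtains c' where "c' > 0" "\<And>m::nat. m \<ge> 1 \<Longrightarrow>
    (INF E\<in>estimators d m. SUP p\<in>horizon_density d ` \<C>.
       \<integral>\<^sup>+S. ennreal ((hellinger d (E S) p)\<^sup>2) \<partial>iid_sample d m p)
    \<le> ennreal (c' * (real m powr (- \<beta> / (\<beta> + 1)) * ln (2 * real m) powr ((2 + \<beta> * b) / (\<beta> + 1))))"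
proof -
  define s where "s = \<beta> / (\<beta> + 1)"
  define p where "p = (2 + \<beta> * b) / (\<beta> + 1)"
  have s: "s > 0" "1 - s = 1 / (\<beta> + 1)" "- \<beta> / (\<beta> + 1) = - s" using \<beta> by (auto simp: s_def field_simps)
  have p: "p > 0" using \<beta> b by (simp add: p_def add_pos_nonneg)
  \<comment> \<open>At this scale the entropy carries the logarithm to the power
    \<open>b - p / \<beta>\<close>, which equals \<open>p - 2 / \<beta>\<close>.\<close>
  have bp: "b - p / \<beta> \<le> p"
  proof -
    have "p * (\<beta> + 1) = 2 + \<beta> * b" using \<beta> by (simp add: p_def)
    then have "p / \<beta> + p = (2 + \<beta> * b) / \<beta>" using \<beta> by (simp add: field_simps)
    also have "\<dots> = 2 / \<beta> + b" using \<beta> by (simp add: field_simps)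
    finally show ?thesis using \<beta> by (smt (verit) divide_pos_pos)
  qed
  have psb: "- p * \<beta> \<le> p" using p \<beta> by (smt (verit) mult_pos_pos minus_mult_left)
  let ?r = "\<lambda>m. real m powr (- s) * ln (2 * real m) powr p"
  obtain A where A: "A > 0" "\<And>m::nat. m \<ge> 1 \<Longrightarrow> ln (2 * real m) powr p \<le> A * real m powr s"
    using ln_double_powr_le_powr[OF s(1)] by metis
  \<comment> \<open>With this factor the scale is at most 1/2 for every \<open>m\<close>, inside the
    range of the entropy bound.\<close>
  define \<kappa> where "\<kappa> = 1 / (2 * A)"
  have \<kappa>: "\<kappa> > 0" using A by (simp add: \<kappa>_def)
  obtain C1 where C1: "C1 > 0" "\<And>m::nat. m \<ge> 1 \<Longrightarrow>
       c * ((\<kappa> * ?r m) powr (- 1 / \<beta>) * ln (2 + 1 / (\<kappa> * ?r m)) powr b)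
       \<le> C1 * (real m powr (1 / (\<beta> + 1)) * ln (2 * real m) powr (b - p / \<beta>))"
    using entropy_upper_at_scale[OF \<kappa> c \<beta> b, of p] unfolding s_def[symmetric] by metis
  obtain C2 where C2: "C2 > 0" "\<And>m::nat. m \<ge> 1 \<Longrightarrow> ln (2 * real m) powr (b - p / \<beta>) \<le> C2 * ln (2 * real m) powr p"
    using ln_double_powr_antimono[OF bp] by metis
  obtain C3 where C3: "C3 > 0" "\<And>m::nat. m \<ge> 1 \<Longrightarrow> ln (2 * real m) powr (- p * \<beta>) \<le> C3 * ln (2 * real m) powr p"
    using ln_double_powr_antimono[OF psb] by metis
  \<comment> \<open>The quotient bounds the entropy divided by \<open>\<epsilon> * real m\<close>;
    the extra 1 leaves a factor \<open>exp (- (\<epsilon> * real m))\<close> in the union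
    bound.\<close>
  define K where "K = C1 * C2 / \<kappa> + 1"
  have K: "K > 0" using C1 C2 \<kappa> by (simp add: K_def add_pos_pos)
  define B where "B = \<beta> powr \<beta> * \<kappa> powr (- \<beta>) * C3"
  have B: "B > 0" using \<beta> \<kappa> C3 by (simp add: B_def)
  define c' where "c' = 2 * (3 + 2 * K) * \<kappa> + 2 * B"
  have c': "c' > 0" using K \<kappa> B by (auto simp: c'_def intro!: add_pos_pos mult_pos_pos)
  have "(INF E\<in>estimators d m. SUP p\<in>horizon_density d ` \<C>.
       \<integral>\<^sup>+S. ennreal ((hellinger d (E S) p)\<^sup>2) \<partial>iid_sample d m p) \<le> ennreal (c' * ?r m)"
    if m: "m \<ge> 1" for m :: nat
  proof -
    have L: "ln (2 * real m) > 0" by (rule ln_double_pos[OF m])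
    define \<epsilon> where "\<epsilon> = \<kappa> * ?r m"
    have \<epsilon>0: "\<epsilon> > 0" using \<kappa> m L by (simp add: \<epsilon>_def)
    have "?r m \<le> real m powr (- s) * (A * real m powr s)"
      using A(2)[OF m] by (intro mult_left_mono) auto
    also have "\<dots> = A" using m by (simp add: powr_minus)
    finally have "\<epsilon> \<le> \<kappa> * A" using \<kappa> by (simp add: \<epsilon>_def)
    then have \<epsilon>1: "\<epsilon> < 1" using A by (simp add: \<kappa>_def)
    have \<epsilon>m: "\<epsilon> * real m = \<kappa> * (real m powr (1 / (\<beta> + 1)) * ln (2 * real m) powr p)"
    proof -
      have "real m powr (- s) * real m = real m powr (- s + 1)"
        using m powr_add[of "real m" "- s" 1] by simp
      also have "- s + 1 = 1 / (\<beta> + 1)" using s by simp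
      finally show ?thesis by (simp add: \<epsilon>_def ac_simps)
    qed
    obtain f n where n: "n > 0" and f: "\<And>j. j < n \<Longrightarrow> f j \<in> \<C>"
      and ent: "packing_entropy \<C> (L1_dist (cube_measure (d - 1))) \<epsilon> = ereal (ln (real n))"
      and cover: "\<And>b. b \<in> \<C> \<Longrightarrow> \<exists>j<n. L1_dist (cube_measure (d - 1)) b (f j) \<le> \<epsilon>"
      using finite_cover_enumeration[OF C(2) entropy[OF \<epsilon>0 \<epsilon>1]] \<epsilon>0 by (metis less_imp_le)
    have "ln (real n) \<le> c * (\<epsilon> powr (- 1 / \<beta>) * ln (2 + 1 / \<epsilon>) powr b)"
      using entropy[OF \<epsilon>0 \<epsilon>1] ent by simp
    also have "\<dots> \<le> C1 * (real m powr (1 / (\<beta> + 1)) * ln (2 * real m) powr (b - p / \<beta>))"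
      unfolding \<epsilon>_def by (rule C1(2)[OF m])
    also have "\<dots> \<le> C1 * (real m powr (1 / (\<beta> + 1)) * (C2 * ln (2 * real m) powr p))"
      using C1(1) C2(2)[OF m] by (intro mult_left_mono) auto
    also have "\<dots> = (K - 1) * (\<epsilon> * real m)"
      unfolding \<epsilon>m using \<kappa> by (simp add: K_def)
    finally have "exp (ln (real n)) \<le> exp ((K - 1) * (\<epsilon> * real m))" by simp
    then have "real n * exp (- K * \<epsilon> * real m) \<le> exp ((K - 1) * (\<epsilon> * real m)) * exp (- K * \<epsilon> * real m)"
      using n by (intro mult_right_mono) auto
    also have "\<dots> = exp (- (\<epsilon> * real m))"
      by (simp flip: exp_add add: algebra_simps)
    \<comment> \<open>Since \<open>\<epsilon> * real m\<close> carries the power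
      \<open>1 / (\<beta> + 1)\<close> of \<open>m\<close>, the exponent \<open>- \<beta>\<close>
      produces exactly \<open>real m powr (- s)\<close>.\<close>
    also have "\<dots> \<le> \<beta> powr \<beta> * (\<epsilon> * real m) powr (- \<beta>)"
      using \<epsilon>0 m by (intro exp_minus_le_powr \<beta>) auto
    also have "(\<epsilon> * real m) powr (- \<beta>) = \<kappa> powr (- \<beta>) * (real m powr (- s) * ln (2 * real m) powr (- p * \<beta>))"
      unfolding \<epsilon>m using powr_scale[OF \<kappa> m, of "1 / (\<beta> + 1)" p "- \<beta>"] by (simp add: s_def)
    also have "\<beta> powr \<beta> * \<dots> \<le> \<beta> powr \<beta> * (\<kappa> powr (- \<beta>) * (real m powr (- s) * (C3 * ln (2 * real m) powr p)))"
      using C3(2)[OF m] by (intro mult_left_mono) auto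
    also have "\<dots> = B * ?r m" by (simp add: B_def)
    finally have tail: "real n * exp (- K * \<epsilon> * real m) \<le> B * ?r m" .
    obtain E where E: "E \<in> estimators d m"
      "\<And>b l. b \<in> continuous_boundaries (d - 1) \<Longrightarrow> l < n \<Longrightarrow> L1_dist (cube_measure (d - 1)) b (f l) \<le> \<epsilon> \<Longrightarrow>
        (\<integral>\<^sup>+S. ennreal ((hellinger d (E S) (horizon_density d b))\<^sup>2) \<partial>iid_sample d m (horizon_density d b))
          \<le> ennreal (2 * (3 + 2 * K) * \<epsilon> + 2 * real n * exp (- K * \<epsilon> * real m))"
    proof (rule empirical_risk_minimizer[of n f d K \<epsilon> m])
      show "f j \<in> continuous_boundaries (d - 1)" if "j < n" for j
        using f[OF that] C(1) by auto
    qed (use n d K \<epsilon>0 in auto)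
    have "2 * (3 + 2 * K) * \<epsilon> + 2 * real n * exp (- K * \<epsilon> * real m) \<le> c' * ?r m"
    proof -
      have "2 * (3 + 2 * K) * \<epsilon> = 2 * (3 + 2 * K) * \<kappa> * ?r m" by (simp add: \<epsilon>_def)
      then show ?thesis using tail by (simp add: c'_def distrib_right)
    qed
    then have le: "ennreal (2 * (3 + 2 * K) * \<epsilon> + 2 * real n * exp (- K * \<epsilon> * real m)) \<le> ennreal (c' * ?r m)"
      by (rule ennreal_leI)
    show ?thesis
    proof (rule INF_lower2[OF E(1)], rule SUP_least)
      fix q assume "q \<in> horizon_density d ` \<C>"
      then obtain h where h: "h \<in> \<C>" "q = horizon_density d h" by auto
      obtain l where "l < n" "L1_dist (cube_measure (d - 1)) h (f l) \<le> \<epsilon>"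
        using cover[OF h(1)] by auto
      with h C(1) show "(\<integral>\<^sup>+S. ennreal ((hellinger d (E S) q)\<^sup>2) \<partial>iid_sample d m q) \<le> ennreal (c' * ?r m)"
        using E(2)[of h l] le by auto
    qed
  qed
  then show thesis using c' that unfolding s(3) p_def by blast
qed

text \<open>The packing scale \<open>\<delta>\<close> is tuned so that the entropy there exceeds the
  entropy at the cover scale \<open>\<epsilon>\<close> plus the logarithmic cost of the change of
  measure.\<close>

theorem horizon_risk_lower_bound:
  fixes \<alpha> \<beta> a b :: real
  assumes d: "d \<ge> 1"
    and C: "\<C> \<subseteq> continuous_boundaries (d - 1)" "\<C> \<noteq> {}"
    and \<alpha>: "\<alpha> > 0" and \<beta>: "\<beta> > 0" and a: "a \<ge> 0" and b: "b \<ge> 0" and c: "c > 0" and c0: "c0 > 0"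
    and entropy: "\<And>\<epsilon>. 0 < \<epsilon> \<Longrightarrow> \<epsilon> < 1 \<Longrightarrow>
      packing_entropy \<C> (L1_dist (cube_measure (d - 1))) \<epsilon>
        \<le> ereal (c * (\<epsilon> powr (- 1 / \<beta>) * ln (2 + 1 / \<epsilon>) powr b))"
    and entropy_lower: "\<And>\<epsilon>. 0 < \<epsilon> \<Longrightarrow> \<epsilon> < 1 \<Longrightarrow>
      ereal (c0 * (\<epsilon> powr (- 1 / \<alpha>) / ln (2 + 1 / \<epsilon>) powr a))
        \<le> packing_entropy \<C> (L1_dist (cube_measure (d - 1))) \<epsilon>"
  obtains c' where "c' > 0" "\<And>m::nat. m \<ge> 1 \<Longrightarrow>
    ennreal (c' * (real m powr (- \<alpha> / (\<beta> + 1)) *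
       ln (2 * real m) powr (- \<alpha> * (2 + \<beta> * b) / (\<beta> + 1) - \<alpha> * a)))
    \<le> (INF E\<in>estimators d m. SUP p\<in>horizon_density d ` \<C>.
       \<integral>\<^sup>+S. ennreal ((hellinger d (E S) p)\<^sup>2) \<partial>iid_sample d m p)"
proof -
  define s where "s = \<beta> / (\<beta> + 1)"
  \<comment> \<open>One power of the logarithm less than in the upper bound: the change of measure
    costs \<open>2 * \<epsilon> * real m * ln (real m)\<close>, whose additional logarithm restores
    the exponent \<open>q\<close>.\<close>
  define p where "p = (2 + \<beta> * b) / (\<beta> + 1) - 1"
  define q where "q = (2 + \<beta> * b) / (\<beta> + 1)"
  define u where "u = 1 / (\<beta> + 1)"
  have s: "s > 0" "1 - s = u" and u: "u > 0" using \<beta> by (auto simp: s_def u_def field_simps)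
  have pq: "p + 1 = q" by (simp add: p_def q_def)
  have bp: "b - p / \<beta> \<le> q"
  proof -
    have "q * (\<beta> + 1) = 2 + \<beta> * b" using \<beta> by (simp add: q_def)
    then have "q / \<beta> + q = (2 + \<beta> * b) / \<beta>" using \<beta> by (simp add: field_simps)
    also have "\<dots> = 2 / \<beta> + b" using \<beta> by (simp add: field_simps)
    finally have "b - p / \<beta> = q - 1 / \<beta>" using \<beta> by (simp add: pq[symmetric] add_divide_distrib)
    then show ?thesis using \<beta> by simp
  qed
  \<comment> \<open>The common order, after taking logarithms, of all costs in the condition
    \<open>large\<close> of \<open>packing_risk_lower_bound\<close>.\<close>
  define X where "X m = real m powr u * ln (2 * real m) powr q" for m :: nat
  let ?r = "\<lambda>m. real m powr (- s) * ln (2 * real m) powr p"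
  obtain A where A: "A > 0" "\<And>m::nat. m \<ge> 1 \<Longrightarrow> ln (2 * real m) powr p \<le> A * real m powr s"
    using ln_double_powr_le_powr[OF s(1)] by metis
  define \<kappa> where "\<kappa> = 1 / (2 * A)"
  have \<kappa>: "\<kappa> > 0" using A by (simp add: \<kappa>_def)
  obtain C1 where C1: "C1 > 0" "\<And>m::nat. m \<ge> 1 \<Longrightarrow>
       c * ((\<kappa> * ?r m) powr (- 1 / \<beta>) * ln (2 + 1 / (\<kappa> * ?r m)) powr b)
       \<le> C1 * (real m powr u * ln (2 * real m) powr (b - p / \<beta>))"
    using entropy_upper_at_scale[OF \<kappa> c \<beta> b, of p] unfolding s_def[symmetric] u_def[symmetric] by metis
  obtain C2 where C2: "C2 > 0" "\<And>m::nat. m \<ge> 1 \<Longrightarrow> ln (2 * real m) powr (b - p / \<beta>) \<le> C2 * ln (2 * real m) powr q"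
    using ln_double_powr_antimono[OF bp] by metis
  have below_X: "\<exists>C>0. \<forall>m\<ge>1. ln (2 * real m) powr v \<le> C * X m" for v
  proof -
    obtain C where C: "C > 0" "\<And>m::nat. m \<ge> 1 \<Longrightarrow> ln (2 * real m) powr (v - q) \<le> C * real m powr u"
      using ln_double_powr_le_powr[OF u] by metis
    have "ln (2 * real m) powr v \<le> C * X m" if m: "m \<ge> 1" for m
    proof -
      have "ln (2 * real m) powr v = ln (2 * real m) powr (v - q) * ln (2 * real m) powr q"
        using ln_double_pos[OF m] by (simp flip: powr_add)
      also have "\<dots> \<le> C * real m powr u * ln (2 * real m) powr q"
        using C(2)[OF m] by (intro mult_right_mono) auto
      finally show ?thesis by (simp add: X_def mult.assoc)
    qed
    then show ?thesis using C(1) by blast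
  qed
  obtain C3 where C3: "C3 > 0" "\<And>m::nat. m \<ge> 1 \<Longrightarrow> ln (2 * real m) powr 0 \<le> C3 * X m"
    using below_X[of 0] by blast
  obtain C4 where C4: "C4 > 0" "\<And>m::nat. m \<ge> 1 \<Longrightarrow> ln (2 * real m) powr 1 \<le> C4 * X m"
    using below_X[of 1] by blast
  \<comment> \<open>The summands account, in turn, for the constants 4 and \<open>exp 2\<close>, for
    the exponent \<open>2 * \<epsilon> * real m\<close>, for the 1 added to it, and for the size of
    the cover.\<close>
  define C5 where "C5 = (ln 4 + 2) * C3 + 2 * \<kappa> + C4 + C1 * C2"

  \<comment> \<open>The exponents \<open>t\<close> and \<open>v\<close> make
    \<open>\<delta> powr (- 1 / \<alpha>)\<close> a constant times
    \<open>X m * ln (2 * real m) powr a\<close>; the last factor absorbs the denominator of the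
    lower entropy bound.\<close>
  define v where "v = \<alpha> * q + \<alpha> * a"
  define t where "t = \<alpha> * u"
  have t: "t > 0" using \<alpha> u by (simp add: t_def)
  let ?D = "\<lambda>m. real m powr (- t) * ln (2 * real m) powr (- v)"
  obtain A1 where A1: "A1 > 0" "\<And>m::nat. m \<ge> 1 \<Longrightarrow> ln (2 * real m) powr (- v) \<le> A1 * real m powr t"
    using ln_double_powr_le_powr[OF t] by metis
  \<comment> \<open>\<open>A2\<close> is uniform in the prefactor of \<open>?D m\<close>, so that
    the prefactor \<open>k\<close> can be chosen afterwards in terms of \<open>A2\<close>.\<close>
  obtain A2 where A2: "A2 > 0" "\<And>\<kappa> m. \<kappa> > 0 \<Longrightarrow> m \<ge> 1 \<Longrightarrow> 1 / (\<kappa> * ?D m) \<le> A2 / \<kappa> * real m powr (t + 1)"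
  proof -
    obtain A2 where A2: "A2 > 0" "\<And>m::nat. m \<ge> 1 \<Longrightarrow> 1 / (1 * ?D m) \<le> A2 / 1 * real m powr (t + 1)"
      using inverse_scale_le[of 1 t "- v"] by auto
    have "1 / (\<kappa> * ?D m) \<le> A2 / \<kappa> * real m powr (t + 1)" if "\<kappa> > 0" "m \<ge> 1" for \<kappa> m
      using divide_right_mono[OF A2(2)[OF that(2)], of \<kappa>] that(1) by (simp add: mult.commute)
    then show thesis using A2(1) that by blast
  qed
  \<comment> \<open>A small \<open>k\<close> raises the entropy at scale \<open>\<delta>\<close> to
    at least \<open>C5 * X m\<close>; the condition \<open>k < 1 / A1\<close> keeps
    \<open>\<delta>\<close> below 1.\<close>
  have "eventually (\<lambda>k. C5 \<le> c0 * (k powr (- 1 / \<alpha>) / (ln (2 + A2 / k) / ln 2 + (t + 1)) powr a)) (at_right 0)"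
    using powr_div_ln_at_top[OF c0 A2(1) \<alpha> a, of "t + 1"] t by (simp add: filterlim_at_top)
  moreover have "eventually (\<lambda>k::real. k < 1 / A1) (at_right 0)"
    using A1(1) by (intro order_tendstoD[OF tendsto_ident_at]) simp
  moreover have "eventually (\<lambda>k::real. 0 < k) (at_right 0)"
    by (rule eventually_at_right_less)
  ultimately have "eventually (\<lambda>k. C5 \<le> c0 * (k powr (- 1 / \<alpha>) / (ln (2 + A2 / k) / ln 2 + (t + 1)) powr a)
      \<and> k < 1 / A1 \<and> 0 < k) (at_right 0)"
    by (intro eventually_conj)
  from eventually_happens'[OF trivial_limit_at_right_real this]
  obtain k where k: "C5 \<le> c0 * (k powr (- 1 / \<alpha>) / (ln (2 + A2 / k) / ln 2 + (t + 1)) powr a)"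
    "k < 1 / A1" "0 < k" by blast

  have "ennreal (k / 8 * ?D m) \<le> (INF E\<in>estimators d m. SUP p\<in>horizon_density d ` \<C>.
       \<integral>\<^sup>+S. ennreal ((hellinger d (E S) p)\<^sup>2) \<partial>iid_sample d m p)"
    if m: "m \<ge> 1" for m :: nat
  proof (rule INF_greatest)
    fix E assume E: "E \<in> estimators d m"
    have L: "ln (2 * real m) > 0" by (rule ln_double_pos[OF m])
    have X: "X m > 0" using L m by (simp add: X_def)
    define \<epsilon> where "\<epsilon> = \<kappa> * ?r m"
    have \<epsilon>0: "\<epsilon> > 0" using \<kappa> m L by (simp add: \<epsilon>_def)
    have "?r m \<le> real m powr (- s) * (A * real m powr s)"
      using A(2)[OF m] by (intro mult_left_mono) auto
    also have "\<dots> = A" using m by (simp add: powr_minus)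
    finally have "\<epsilon> \<le> \<kappa> * A" using \<kappa> by (simp add: \<epsilon>_def)
    then have \<epsilon>1: "\<epsilon> < 1" using A by (simp add: \<kappa>_def)
    have \<epsilon>m: "\<epsilon> * real m * ln (2 * real m) = \<kappa> * X m"
    proof -
      have "real m powr (- s) * real m = real m powr (- s + 1)"
        using m powr_add[of "real m" "- s" 1] by simp
      also have "- s + 1 = u" using s by simp
      finally have 1: "real m powr (- s) * real m = real m powr u" .
      have 2: "ln (2 * real m) powr p * ln (2 * real m) = ln (2 * real m) powr q"
        unfolding pq[symmetric] using L by (simp add: powr_add)
      have "\<epsilon> * real m * ln (2 * real m)
          = \<kappa> * ((real m powr (- s) * real m) * (ln (2 * real m) powr p * ln (2 * real m)))"
        by (simp add: \<epsilon>_def)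
      then show ?thesis by (simp only: 1 2 X_def)
    qed
    obtain g N where N: "N > 0" and g: "\<And>j. j < N \<Longrightarrow> g j \<in> \<C>"
      and entN: "packing_entropy \<C> (L1_dist (cube_measure (d - 1))) \<epsilon> = ereal (ln (real N))"
      and cover: "\<And>b. b \<in> \<C> \<Longrightarrow> \<exists>j<N. L1_dist (cube_measure (d - 1)) b (g j) \<le> \<epsilon>"
      using finite_cover_enumeration[OF C(2) entropy[OF \<epsilon>0 \<epsilon>1]] \<epsilon>0 by (metis less_imp_le)
    have "ln (real N) \<le> c * (\<epsilon> powr (- 1 / \<beta>) * ln (2 + 1 / \<epsilon>) powr b)"
      using entropy[OF \<epsilon>0 \<epsilon>1] entN by simp
    also have "\<dots> \<le> C1 * (real m powr u * ln (2 * real m) powr (b - p / \<beta>))"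
      unfolding \<epsilon>_def by (rule C1(2)[OF m])
    also have "\<dots> \<le> C1 * (real m powr u * (C2 * ln (2 * real m) powr q))"
      using C1(1) C2(2)[OF m] by (intro mult_left_mono) auto
    finally have lnN: "ln (real N) \<le> C1 * C2 * X m" by (simp add: X_def ac_simps)

    define \<delta> where "\<delta> = k * ?D m"
    have \<delta>0: "\<delta> > 0" using k m L by (simp add: \<delta>_def)
    have "?D m \<le> real m powr (- t) * (A1 * real m powr t)"
      using A1(2)[OF m] by (intro mult_left_mono) auto
    also have "\<dots> = A1" using m by (simp add: powr_minus)
    finally have "\<delta> \<le> k * A1" using k by (simp add: \<delta>_def)
    also have "\<dots> < 1" using k A1 by (simp add: field_simps)
    finally have \<delta>1: "\<delta> < 1" .
    obtain f M where M: "M > 0" and f: "\<And>j. j < M \<Longrightarrow> f j \<in> \<C>"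
      and entM: "packing_entropy \<C> (L1_dist (cube_measure (d - 1))) \<delta> = ereal (ln (real M))"
      and packing: "\<And>i j. i < M \<Longrightarrow> j < M \<Longrightarrow> i \<noteq> j \<Longrightarrow> \<delta> < L1_dist (cube_measure (d - 1)) (f i) (f j)"
      using finite_cover_enumeration[OF C(2) entropy[OF \<delta>0 \<delta>1]] \<delta>0 by (metis less_imp_le)
    define W where "W = ln (2 + A2 / k) / ln 2 + (t + 1)"
    have W0: "ln (2 + A2 / k) / ln 2 \<ge> 0"
      using A2 k by (intro divide_nonneg_nonneg ln_ge_zero) auto
    then have W: "W > 0" unfolding W_def using t by linarith
    have "ln (2 + 1 / \<delta>) \<le> W * ln (2 * real m)"
      unfolding W_def \<delta>_def using A2(2)[OF k(3) m] A2(1) k(3) t m L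
      by (intro ln_two_plus_le) auto
    then have "ln (2 + 1 / \<delta>) powr a \<le> (W * ln (2 * real m)) powr a"
      using a \<delta>0 by (intro powr_mono2) auto
    also have "\<dots> = W powr a * ln (2 * real m) powr a" using W L by (simp add: powr_mult)
    finally have lnd: "ln (2 + 1 / \<delta>) powr a \<le> W powr a * ln (2 * real m) powr a" .
    have "- t * (- 1 / \<alpha>) = u" "- v * (- 1 / \<alpha>) = q + a"
      using \<alpha> by (auto simp: t_def v_def field_simps)
    then have dpow: "\<delta> powr (- 1 / \<alpha>) = k powr (- 1 / \<alpha>) * (X m * ln (2 * real m) powr a)"
      unfolding \<delta>_def using powr_scale[OF k(3) m, of "- t" "- v" "- 1 / \<alpha>"] L
      by (simp add: X_def powr_add)
    have "1 < 2 + 1 / \<delta>" using \<delta>0 by (simp add: add_strict_increasing)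
    then have lnd0: "ln (2 + 1 / \<delta>) > 0" by (rule ln_gt_zero)
    have "C5 * X m \<le> c0 * (k powr (- 1 / \<alpha>) / W powr a) * X m"
      using k(1) X by (intro mult_right_mono) (auto simp: W_def)
    also have "\<dots> = c0 * (\<delta> powr (- 1 / \<alpha>) / (W powr a * ln (2 * real m) powr a))"
      unfolding dpow using L by simp
    also have "\<dots> \<le> c0 * (\<delta> powr (- 1 / \<alpha>) / ln (2 + 1 / \<delta>) powr a)"
      using c0 \<delta>0 lnd lnd0 W L by (intro mult_left_mono divide_left_mono mult_pos_pos) auto
    also have "\<dots> \<le> ln (real M)"
      using entropy_lower[OF \<delta>0 \<delta>1] entM by simp
    finally have lnM: "C5 * X m \<le> ln (real M)" .

    \<comment> \<open>The condition \<open>large\<close> is verified on the logarithmic scale, where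
      each summand is at most a multiple of \<open>X m\<close>.\<close>
    have "ln (4 * (real m powr (2 * \<epsilon> * real m + 1) * (real N * exp 2)))
        = ln 4 + ((2 * \<epsilon> * real m + 1) * ln (real m) + (ln (real N) + 2))"
      using m N by (simp add: ln_mult ln_powr)
    also have "(2 * \<epsilon> * real m + 1) * ln (real m) \<le> (2 * \<epsilon> * real m + 1) * ln (2 * real m)"
      using \<epsilon>0 m by (intro mult_left_mono) auto
    also have "\<dots> = 2 * \<kappa> * X m + ln (2 * real m)"
      using \<epsilon>m by (simp add: distrib_right mult.assoc)
    also have "ln (2 * real m) \<le> C4 * X m" using C4(2)[OF m] L by simp
    also have "ln 4 + (2 * \<kappa> * X m + C4 * X m + (ln (real N) + 2))
        \<le> (ln 4 + 2) * (C3 * X m) + (2 * \<kappa> * X m + C4 * X m + C1 * C2 * X m)"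
    proof -
      have "(ln 4 + 2) * 1 \<le> (ln 4 + 2) * (C3 * X m)"
        using C3(2)[OF m] L by (intro mult_left_mono) auto
      then have "ln 4 + 2 \<le> (ln 4 + 2) * (C3 * X m)" by simp
      moreover have "x + 2 \<le> y \<Longrightarrow> z \<le> w \<Longrightarrow> x + (v + (z + 2)) \<le> y + (v + w)" for x y z w v :: real
        by linarith
      ultimately show ?thesis using lnN by blast
    qed
    also have "\<dots> = C5 * X m" by (simp add: C5_def algebra_simps)
    also note lnM
    finally have "ln (4 * (real m powr (2 * \<epsilon> * real m + 1) * (real N * exp 2))) \<le> ln (real M)"
      by simp
    then have large: "4 * (real m powr (2 * \<epsilon> * real m + 1) * (real N * exp 2)) \<le> real M"
      using m N M by (subst (asm) ln_le_cancel_iff) auto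

    have f': "\<And>j. j < M \<Longrightarrow> f j \<in> continuous_boundaries (d - 1)"
      and g': "\<And>j. j < N \<Longrightarrow> g j \<in> continuous_boundaries (d - 1)"
      using f g C(1) by auto
    have "\<exists>j<M. ennreal (\<delta> / 8) \<le>
      (\<integral>\<^sup>+S. ennreal ((hellinger d (E S) (horizon_density d (f j)))\<^sup>2) \<partial>iid_sample d m (horizon_density d (f j)))"
    proof (rule packing_risk_lower_bound[where g = g and N = N and \<epsilon> = \<epsilon>])
      show "\<exists>k<N. L1_dist (cube_measure (d - 1)) (f j) (g k) \<le> \<epsilon>" if "j < M" for j
        by (rule cover[OF f[OF that]])
    qed (use f' g' d m M packing large less_imp_le[OF \<delta>0] E in simp_all)
    then obtain j where j: "j < M" "ennreal (\<delta> / 8) \<le>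
      (\<integral>\<^sup>+S. ennreal ((hellinger d (E S) (horizon_density d (f j)))\<^sup>2) \<partial>iid_sample d m (horizon_density d (f j)))"
      by blast
    have "ennreal (k / 8 * ?D m) = ennreal (\<delta> / 8)" by (simp add: \<delta>_def)
    also note j(2)
    also have "(\<integral>\<^sup>+S. ennreal ((hellinger d (E S) (horizon_density d (f j)))\<^sup>2) \<partial>iid_sample d m (horizon_density d (f j)))
        \<le> (SUP p\<in>horizon_density d ` \<C>. \<integral>\<^sup>+S. ennreal ((hellinger d (E S) p)\<^sup>2) \<partial>iid_sample d m p)"
      by (rule SUP_upper) (use f j in auto)
    finally show "ennreal (k / 8 * ?D m)
        \<le> (SUP p\<in>horizon_density d ` \<C>. \<integral>\<^sup>+S. ennreal ((hellinger d (E S) p)\<^sup>2) \<partial>iid_sample d m p)" .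
  qed
  note main = this
  have t': "- t = - \<alpha> / (\<beta> + 1)" by (simp add: t_def u_def)
  have v': "- v = - \<alpha> * (2 + \<beta> * b) / (\<beta> + 1) - \<alpha> * a" by (simp add: v_def q_def)
  show thesis
  proof (rule that[of "k / 8"])
    show "k / 8 > 0" using k(3) by simp
  qed (rule main[unfolded t' v'])
qed

theorem theorem3p14:
  fixes d :: nat
    and \<C> :: "((nat \<Rightarrow> real) \<Rightarrow> real) set"
    and \<alpha> \<beta> a b :: real
  assumes d: "d \<ge> 2"
    and C: "\<C> \<subseteq> continuous_boundaries (d - 1)" "\<C> \<noteq> {}"
    and exponents: "\<alpha> \<ge> \<beta>" "\<beta> > 0" "a \<ge> 0" "b \<ge> 0"
    and entropy_upper: "\<exists>c>0. \<forall>\<epsilon>. 0 < \<epsilon> \<and> \<epsilon> < 1 \<longrightarrow>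
      packing_entropy \<C> (L1_dist (cube_measure (d - 1))) \<epsilon>
        \<le> ereal (c * (\<epsilon> powr (- 1 / \<beta>) * ln (2 + 1 / \<epsilon>) powr b))"
    and entropy_lower: "\<exists>c>0. \<forall>\<epsilon>. 0 < \<epsilon> \<and> \<epsilon> < 1 \<longrightarrow>
      ereal (c * (\<epsilon> powr (- 1 / \<alpha>) / ln (2 + 1 / \<epsilon>) powr a))
        \<le> packing_entropy \<C> (L1_dist (cube_measure (d - 1))) \<epsilon>"
  shows "\<exists>c>0. \<exists>c'>0. \<forall>m::nat. m \<ge> 1 \<longrightarrow>
    (let risk = (INF E\<in>estimators d m. SUP p\<in>horizon_density d ` \<C>.
                   \<integral>\<^sup>+S. ennreal ((hellinger d (E S) p)\<^sup>2) \<partial>iid_sample d m p)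
     in ennreal (c * (real m powr (- \<alpha> / (\<beta> + 1)) *
                   ln (2 * real m) powr (- \<alpha> * (2 + \<beta> * b) / (\<beta> + 1) - \<alpha> * a))) \<le> risk
      \<and> risk \<le> ennreal (c' * (real m powr (- \<beta> / (\<beta> + 1)) *
                   ln (2 * real m) powr ((2 + \<beta> * b) / (\<beta> + 1)))))"
proof -
  have d1: "d \<ge> 1" and \<alpha>: "\<alpha> > 0" using d exponents by auto
  obtain cu where cu: "cu > 0" "\<And>\<epsilon>. 0 < \<epsilon> \<Longrightarrow> \<epsilon> < 1 \<Longrightarrow>
      packing_entropy \<C> (L1_dist (cube_measure (d - 1))) \<epsilon>
        \<le> ereal (cu * (\<epsilon> powr (- 1 / \<beta>) * ln (2 + 1 / \<epsilon>) powr b))"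
    using entropy_upper by blast
  obtain cl where cl: "cl > 0" "\<And>\<epsilon>. 0 < \<epsilon> \<Longrightarrow> \<epsilon> < 1 \<Longrightarrow>
      ereal (cl * (\<epsilon> powr (- 1 / \<alpha>) / ln (2 + 1 / \<epsilon>) powr a))
        \<le> packing_entropy \<C> (L1_dist (cube_measure (d - 1))) \<epsilon>"
    using entropy_lower by blast
  from horizon_risk_lower_bound[OF d1 C \<alpha> exponents(2-4) cu(1) cl(1) cu(2) cl(2)]
  obtain c where c: "c > 0" "\<And>m::nat. m \<ge> 1 \<Longrightarrow>
    ennreal (c * (real m powr (- \<alpha> / (\<beta> + 1)) *
       ln (2 * real m) powr (- \<alpha> * (2 + \<beta> * b) / (\<beta> + 1) - \<alpha> * a)))
    \<le> (INF E\<in>estimators d m. SUP p\<in>horizon_density d ` \<C>.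
       \<integral>\<^sup>+S. ennreal ((hellinger d (E S) p)\<^sup>2) \<partial>iid_sample d m p)" by blast
  from horizon_risk_upper_bound[OF d1 C exponents(2,4) cu]
  obtain c' where c': "c' > 0" "\<And>m::nat. m \<ge> 1 \<Longrightarrow>
    (INF E\<in>estimators d m. SUP p\<in>horizon_density d ` \<C>.
       \<integral>\<^sup>+S. ennreal ((hellinger d (E S) p)\<^sup>2) \<partial>iid_sample d m p)
    \<le> ennreal (c' * (real m powr (- \<beta> / (\<beta> + 1)) * ln (2 * real m) powr ((2 + \<beta> * b) / (\<beta> + 1))))"
    by blast
  show ?thesis
    unfolding Let_def using c(1) c'(1)
    by (intro exI[of _ c] exI[of _ c'] conjI allI impI c(2) c'(2))
qed

end
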